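(* Consider the finite sum case $f(x)=\frac1n\sum_{i=1}^n f_i(x)$, $f_i(x)=\frac1m\sum_{j=1}^m f_{ij}(x)$, $x\in\mathbb{R}^d$. Assume there exists $f_*\in\mathbb{R}$ with $f(x)\ge f_*$ for all $x\in\mathbb{R}^d$; that $f_i$ is $L_i$-smooth for all $i\in\{1,\dots,n\}$, i.e. $\|\nabla f_i(x)-\nabla f_i(y)\|\le L_i\|x-y\|$ for all $x,y\in\mathbb{R}^d$; that the average $\mathcal{L}$-smoothness assumption (see context) holds with constants $\mathcal{L}_i\ge0$; and that $f$ satisfies the Polyak–Łojasiewicz condition with parameter $\mu$, i.e. $\|\nabla f(x)\|^2\ge2\mu(f(x)-f(x^* ))$ for all $x\in\mathbb{R}^d$, where $x^*=\arg\min_{x\in\mathbb{R}^d}f(x)$. Put $L^2=\frac1n\sum_{i=1}^nL_i^2$, $\mathcal{L}^2=\frac1n\sum_{i=1}^n\mathcal{L}_i^2$ and $\Delta_0=f(x^0)-f(x^* )$. Let $\mathcal{Q}$ be a quantization operator with parameter $\omega$ and expected density $\zeta_{\mathcal Q}$, and let $p=\min\left\{\frac{\zeta_{\mathcal Q}}{d},\frac{b'}{m+b'}\right\}$, where $b'\le m$. If $$\gamma\le\min\left\{\frac{1}{L+\sqrt{\frac{2\max\{d/\zeta_{\mathcal Q}-1,\,m/b'\}}{n}\left(\omega L^2+\frac{(1+\omega)\mathcal{L}^2}{b'}\right)}},\frac{p}{2\mu}\right\},$$ then VR-MARINA (finite sum case) requires $$\mathcal{O}\left(\max\left\{\frac1p,\frac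 L\mu\left(1+\sqrt{\frac{\omega\max\{d/\zeta_{\mathcal Q}-1,\,m/b'\}}{n}}\right)+\frac{\mathcal{L}}{\mu}\sqrt{\frac{(1+\omega)\max\{d/\zeta_{\mathcal Q}-1,\,m/b'\}}{nb'}}\right\}\log\frac{\Delta_0}{\varepsilon}\right)$$ iterations/communication rounds, $$\mathcal{O}\left(m+\max\left\{\frac{b'}p,\frac L\mu\left(b'+\sqrt{\frac{\omega\max\{(d/\zeta_{\mathcal Q}-1)(b')^2,\,mb'\}}{n}}\right)+\frac{\mathcal{L}}{\mu}\sqrt{\frac{(1+\omega)\max\{(d/\zeta_{\mathcal Q}-1)b',\,m\}}{n}}\right\}\log\frac{\Delta_0}{\varepsilon}\right)$$ stochastic oracle calls per node in expectation to achieve $\mathbf{E}[f(x^K)-f(x^* )]\le\varepsilon$, and the expected total communication cost per worker is $$\mathcal{O}\left(d+\zeta_{\mathcal Q}\max\left\{\frac1p,\frac L\mu\left(1+\sqrt{\frac{\omega\max\{d/\zeta_{\mathcal Q}-1,\,m/b'\}}{n}}\right)+\frac{\mathcal{L}}{\mu}\sqrt{\frac{(1+\omega)\max\{d/\zeta_{\mathcal Q}-1,\,m/b'\}}{nb'}}\right\}\log\frac{\Delta_0}{\varepsilon}\right)$$ under an assumption that the communication cost is proportional to the number of non-zero components of transmitted vectors from workers to the server.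
   Context: $\|\cdot\|$ is the Euclidean norm; $\|y\|_0$ is the number of non-zero components of $y\in\mathbb{R}^d$. Quantization operator: a stochastic mapping $\mathcal{Q}:\mathbb{R}^d\to\mathbb{R}^d$ for which there is $\omega>0$ with $\mathbf{E}[\mathcal{Q}(x)]=x$ and $\mathbf{E}[\|\mathcal{Q}(x)-x\|^2]\le\omega\|x\|^2$ for any $x\in\mathbb{R}^d$. Its expected density is $\zeta_{\mathcal Q}=\sup_{x\in\mathbb{R}^d}\mathbf{E}[\|\mathcal{Q}(x)\|_0]$. VR-MARINA, finite sum case (a distributed method with $n$ workers, worker $i$ having access to $f_i$, and a server; input: starting point $x^0$, stepsize $\gamma$, minibatch size $b'$, probability $p\in(0,1]$, number of iterations $K$): initialize $g^0=\nabla f(x^0)$. For $k=0,\dots,K-1$: sample $c_k\sim\mathrm{Bernoulli}(p)$ and broadcast $g^k$ to all workers; each worker $i=1,\dots,n$ in parallel computes $x^{k+1}=x^k-\gamma g^k$ and sets $g_i^{k+1}=\nabla f_i(x^{k+1})$ if $c_k=1$, and $g_i^{k+1}=g^k+\mathcal{Q}(\widetilde\Delta_i^k)$ otherwise, where $\widetilde\Delta_i^k=\frac1{b'}\sum_{j\in I'_{i,k}}(\nabla f_{ij}(x^{k+1})-\nabla f_{ij}(x^k))$ and $I'_{i,k}$ is the set of the indices in the minibatch, $|I'_{i,k}|=b'$; then $g^{k+1}=\frac1n\sum_{i=1}^n g_i^{k+1}$. The point considered here is the last iterate $x^K$. Average $\mathcal{L}$-smoothness: for all $k\ge0$ and $i\in\{1,\dots,n\}$,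 with $\Delta_i^k=\nabla f_i(x^{k+1})-\nabla f_i(x^k)$, one has $\mathbf{E}[\widetilde\Delta_i^k\mid x^k,x^{k+1}]=\Delta_i^k$ and $\mathbf{E}[\|\widetilde\Delta_i^k-\Delta_i^k\|^2\mid x^k,x^{k+1}]\le\frac{\mathcal{L}_i^2}{b'}\|x^{k+1}-x^k\|^2$ with some $\mathcal{L}_i\ge0$. A stochastic oracle call is the computation of one gradient $\nabla f_{ij}$ at one point.
   Formalization: The bounds fail for very small γ, so γ is also assumed to be at least θ times the stated minimum (any θ>0), with O-constant 10/θ; further 0<ε≤Δ₀ is assumed, and the iteration bound is rounded up to an integer. *)

theory Defs
  imports "HOL-Probability.Probability"
begin

definition grad :: "('a::real_inner \<Rightarrow> real) \<Rightarrow> 'a \<Rightarrow> 'a" where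
  "grad h x = (THE D. GDERIV h x :> D)"

lemma GDERIV_grad:
  fixes h :: "real ^ 'd \<Rightarrow> real"
  assumes "h differentiable (at x)"
  shows "GDERIV h x :> grad h x"
proof -
  obtain h' where h': "(h has_derivative h') (at x)"
    using assms by (auto simp: differentiable_def)
  then interpret bounded_linear h' by (rule has_derivative_bounded_linear)
  have "h' = (\<lambda>y. y \<bullet> adjoint h' 1)"
    using adjoint_works[OF linear_axioms, of _ 1] by (auto simp: fun_eq_iff)
  then have D: "GDERIV h x :> adjoint h' 1"
    using h' by (simp add: gderiv_def)
  have "E = D'" if "GDERIV h x :> E" "GDERIV h x :> D'" for E D'
    using has_derivative_unique[OF that[unfolded gderiv_def]]
    by (metis vector_eq_ldot)
  with D show ?thesis unfolding grad_def by (metis theI)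
qed

definition l0norm :: "real ^ 'd \<Rightarrow> nat" where
  "l0norm y = card {e. y $ e \<noteq> 0}"


text \<open>
  A stochastic mapping of \<open>\<real>\<^sup>d\<close> is represented by a seed space \<open>U\<close> and a jointly measurable
  function \<open>Q\<close>: the random vector usually written \<open>Q(x)\<close> is \<open>\<lambda>u. Q u x\<close> with \<open>u\<close> drawn from \<open>U\<close>.
  Integrability is required explicitly because the Bochner integral of a non-integrable function
  is \<open>0\<close>.
\<close>

definition quantization ::
    "'u measure \<Rightarrow> ('u \<Rightarrow> real ^ 'd \<Rightarrow> real ^ 'd) \<Rightarrow> real \<Rightarrow> bool" where
  "quantization U Q \<omega> \<longleftrightarrow>
     prob_space U \<and>
     (\<lambda>(u, x). Q u x) \<in> borel_measurable (U \<Otimes>\<^sub>M borel) \<and>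
     \<omega> > 0 \<and>
     (\<forall>x. integrable U (\<lambda>u. Q u x) \<and> (\<integral>u. Q u x \<partial>U) = x \<and>
          integrable U (\<lambda>u. (norm (Q u x - x))\<^sup>2) \<and>
          (\<integral>u. (norm (Q u x - x))\<^sup>2 \<partial>U) \<le> \<omega> * (norm x)\<^sup>2)"

definition expected_density :: "'u measure \<Rightarrow> ('u \<Rightarrow> real ^ 'd \<Rightarrow> real ^ 'd) \<Rightarrow> real" where
  "expected_density U Q = (SUP x. \<integral>u. real (l0norm (Q u x)) \<partial>U)"


text \<open>Workers are indexed by \<open>{1..n}\<close>, the components of every local objective by \<open>{1..m}\<close>.\<close>

definition local_obj :: "nat \<Rightarrow> (nat \<Rightarrow> nat \<Rightarrow> 'v \<Rightarrow> real) \<Rightarrow> nat \<Rightarrow> 'v \<Rightarrow> real" where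
  "local_obj m f i x = (1 / real m) * (\<Sum>j=1..m. f i j x)"

definition global_obj :: "nat \<Rightarrow> nat \<Rightarrow> (nat \<Rightarrow> nat \<Rightarrow> 'v \<Rightarrow> real) \<Rightarrow> 'v \<Rightarrow> real" where
  "global_obj n m f x = (1 / real n) * (\<Sum>i=1..n. local_obj m f i x)"

definition minibatch_diff ::
    "nat \<Rightarrow> (nat \<Rightarrow> nat \<Rightarrow> real ^ 'd \<Rightarrow> real) \<Rightarrow> nat \<Rightarrow> nat set \<Rightarrow> real ^ 'd \<Rightarrow> real ^ 'd \<Rightarrow> real ^ 'd" where
  "minibatch_diff b f i S x y = (1 / real b) *\<^sub>R (\<Sum>j\<in>S. grad (f i j) y - grad (f i j) x)"


text \<open>
  One run of VR-MARINA for given outcomes of the sampling: \<open>c k\<close> is the coin \<open>c\<^sub>k\<close>, \<open>S i k\<close> the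
  minibatch of worker \<open>i\<close> in iteration \<open>k\<close>, and \<open>q i k\<close> the realized quantization map of worker
  \<open>i\<close> in iteration \<open>k\<close>.  The sequences \<open>x\<close> and \<open>g\<close> are those the run produces; they do not depend
  on the number of iterations after which it is stopped.
\<close>

definition vr_marina_worker ::
    "nat \<Rightarrow> nat \<Rightarrow> (nat \<Rightarrow> nat \<Rightarrow> real ^ 'd \<Rightarrow> real) \<Rightarrow> (nat \<Rightarrow> bool) \<Rightarrow> (nat \<Rightarrow> nat \<Rightarrow> nat set) \<Rightarrow>
     (nat \<Rightarrow> nat \<Rightarrow> real ^ 'd \<Rightarrow> real ^ 'd) \<Rightarrow> (nat \<Rightarrow> real ^ 'd) \<Rightarrow> (nat \<Rightarrow> real ^ 'd) \<Rightarrow>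
     nat \<Rightarrow> nat \<Rightarrow> real ^ 'd" where
  "vr_marina_worker m b f c S q x g i k =
     (if c k then grad (local_obj m f i) (x (Suc k))
      else g k + q i k (minibatch_diff b f i (S i k) (x k) (x (Suc k))))"

definition vr_marina_run ::
    "nat \<Rightarrow> nat \<Rightarrow> nat \<Rightarrow> (nat \<Rightarrow> nat \<Rightarrow> real ^ 'd \<Rightarrow> real) \<Rightarrow> real \<Rightarrow> real ^ 'd \<Rightarrow>
     (nat \<Rightarrow> bool) \<Rightarrow> (nat \<Rightarrow> nat \<Rightarrow> nat set) \<Rightarrow> (nat \<Rightarrow> nat \<Rightarrow> real ^ 'd \<Rightarrow> real ^ 'd) \<Rightarrow>
     (nat \<Rightarrow> real ^ 'd) \<Rightarrow> (nat \<Rightarrow> real ^ 'd) \<Rightarrow> bool" where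
  "vr_marina_run n m b f \<gamma> x0 c S q x g \<longleftrightarrow>
     x 0 = x0 \<and> g 0 = grad (global_obj n m f) x0 \<and>
     (\<forall>k. x (Suc k) = x k - \<gamma> *\<^sub>R g k \<and>
          g (Suc k) = (1 / real n) *\<^sub>R (\<Sum>i=1..n. vr_marina_worker m b f c S q x g i k))"


text \<open>
  The sampling in VR-MARINA: all coins, all minibatches and all seeds of the quantizations are
  mutually independent.  The distribution of the minibatches is not prescribed here; it is only
  restricted by the average smoothness assumption below.
\<close>

datatype sample = Coin nat | Batch nat nat | Seed nat nat

definition vr_marina_sampling ::
    "'s measure \<Rightarrow> 'u measure \<Rightarrow> nat \<Rightarrow> nat \<Rightarrow> nat \<Rightarrow> real \<Rightarrow>
     (nat \<Rightarrow> 's \<Rightarrow> bool) \<Rightarrow> (nat \<Rightarrow> nat \<Rightarrow> 's \<Rightarrow> nat set) \<Rightarrow> (nat \<Rightarrow> nat \<Rightarrow> 's \<Rightarrow> 'u) \<Rightarrow> bool" where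
  "vr_marina_sampling M U n m b p c S \<xi> \<longleftrightarrow>
     prob_space M \<and>
     (\<forall>k. c k \<in> M \<rightarrow>\<^sub>M count_space UNIV \<and>
          distr M (count_space UNIV) (c k) = measure_pmf (bernoulli_pmf p)) \<and>
     (\<forall>i\<in>{1..n}. \<forall>k. S i k \<in> M \<rightarrow>\<^sub>M count_space {A. A \<subseteq> {1..m} \<and> card A = b}) \<and>
     (\<forall>i\<in>{1..n}. \<forall>k. \<xi> i k \<in> M \<rightarrow>\<^sub>M U \<and> distr M U (\<xi> i k) = U) \<and>
     prob_space.indep_sets M
       (\<lambda>t. case t of
              Coin k \<Rightarrow> sets (vimage_algebra (space M) (c k) (count_space UNIV))
            | Batch i k \<Rightarrow> sets (vimage_algebra (space M) (S i k)
                              (count_space {A. A \<subseteq> {1..m} \<and> card A = b}))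
            | Seed i k \<Rightarrow> sets (vimage_algebra (space M) (\<xi> i k) U))
       ({Coin k | k. True} \<union> {Batch i k | i k. i \<in> {1..n}} \<union> {Seed i k | i k. i \<in> {1..n}})"


text \<open>
  Average \<open>\<L>\<close>-smoothness.  The conditional expectations are given the \<open>\<sigma>\<close>-algebra generated by
  \<open>x\<^sup>k\<close> and \<open>x\<^sup>k\<^sup>+\<^sup>1\<close>; the vector-valued one is taken componentwise, and the one of the squared
  norm is the version for nonnegative functions with values in \<open>[0, \<infinity>]\<close>.
\<close>

definition average_smooth ::
    "'s measure \<Rightarrow> nat \<Rightarrow> nat \<Rightarrow> nat \<Rightarrow> (nat \<Rightarrow> nat \<Rightarrow> real ^ 'd \<Rightarrow> real) \<Rightarrow>
     (nat \<Rightarrow> nat \<Rightarrow> 's \<Rightarrow> nat set) \<Rightarrow> (nat \<Rightarrow> 's \<Rightarrow> real ^ 'd) \<Rightarrow> (nat \<Rightarrow> real) \<Rightarrow> bool" where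
  "average_smooth M n m b f S x \<L> \<longleftrightarrow>
     (\<forall>k. \<forall>i\<in>{1..n}.
        let F = vimage_algebra (space M) (\<lambda>s. (x k s, x (Suc k) s)) (borel \<Otimes>\<^sub>M borel);
            \<Delta>' = (\<lambda>s. minibatch_diff b f i (S i k s) (x k s) (x (Suc k) s));
            \<Delta> = (\<lambda>s. grad (local_obj m f i) (x (Suc k) s) - grad (local_obj m f i) (x k s))
        in \<L> i \<ge> 0 \<and>
           (\<forall>e. AE s in M. real_cond_exp M F (\<lambda>s. \<Delta>' s $ e) s = \<Delta> s $ e) \<and>
           (AE s in M. nn_cond_exp M F (\<lambda>s. ennreal ((norm (\<Delta>' s - \<Delta> s))\<^sup>2)) s
                         \<le> ennreal ((\<L> i)\<^sup>2 / real b * (norm (x (Suc k) s - x k s))\<^sup>2)))"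


text \<open>
  Oracle calls of one node in \<open>K\<close> iterations: \<open>m\<close> for \<open>g\<^sup>0\<close>, and in every iteration \<open>m\<close> for a full
  local gradient or \<open>2b\<close> for the minibatch gradients at the two points \<open>x\<^sup>k\<^sup>+\<^sup>1\<close> and \<open>x\<^sup>k\<close>.
\<close>

definition oracle_calls :: "nat \<Rightarrow> nat \<Rightarrow> (nat \<Rightarrow> bool) \<Rightarrow> nat \<Rightarrow> nat" where
  "oracle_calls m b c K = m + (\<Sum>k<K. if c k then m else 2 * b)"

text \<open>
  Number of non-zero components worker \<open>i\<close> sends to the server in \<open>K\<close> iterations: those of
  \<open>\<nabla>f\<^sub>i(x\<^sup>0)\<close> for \<open>g\<^sup>0\<close>, and in every iteration those of the full local gradient or of the quantized
  difference (the server knows \<open>g\<^sup>k\<close>, which is therefore not sent).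
\<close>

definition sent_components ::
    "nat \<Rightarrow> nat \<Rightarrow> (nat \<Rightarrow> nat \<Rightarrow> real ^ 'd \<Rightarrow> real) \<Rightarrow> (nat \<Rightarrow> bool) \<Rightarrow> (nat \<Rightarrow> nat \<Rightarrow> nat set) \<Rightarrow>
     (nat \<Rightarrow> nat \<Rightarrow> real ^ 'd \<Rightarrow> real ^ 'd) \<Rightarrow> (nat \<Rightarrow> real ^ 'd) \<Rightarrow> nat \<Rightarrow> nat \<Rightarrow> nat" where
  "sent_components m b f c S q x i K =
     l0norm (grad (local_obj m f i) (x 0)) +
     (\<Sum>k<K. if c k then l0norm (grad (local_obj m f i) (x (Suc k)))
             else l0norm (q i k (minibatch_diff b f i (S i k) (x k) (x (Suc k)))))"

end

theory Submission
  imports Defs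
begin

text \<open>
  Conditionally on the past, the error of the gradient estimator after an iteration without a full
  gradient is the old error plus centered noise that is independent across workers: minibatch noise,
  and on top of it quantization noise. Hence its second moment grows by at most a multiple of the
  squared step and is multiplied by the probability \<open>1 - p\<close>. Together with the descent lemma and
  the PL inequality this makes the potential
  \<open>E[f(x\<^sup>k) - f\<^sub>*] + (\<gamma>/p) E\<parallel>g\<^sup>k - \<nabla>f(x\<^sup>k)\<parallel>\<^sup>2\<close> contract by \<open>1 - \<gamma>\<mu>\<close> in every iteration. Working with
  extended nonnegative integrals avoids any a priori integrability of the iterates.
\<close>

section \<open>Gradients and smooth functions\<close>

text \<open>The smoothness assumption conditions only on x^k and x^{k+1}, whereas the error
  recursion must condition on the whole past and on the workers already treated. The bridge is
  freezing: a minibatch is independent of everything else drawn so far, so its conditional moments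
  are plain integrals over the minibatch with the iterates held fixed, and these remain usable given
  any further independent information. The iterates count as known, because x^{k+1} uses only g^k
  and is fixed before the samples of iteration k matter. The weight \<gamma>/p balances the error:
  the factor 1 - p takes \<gamma> off the weight, of which \<gamma>/2 pays for the error in the
  descent step and \<gamma>/2 for the contraction, whence \<gamma> \<le> p/(2\<mu>). The other
  stepsize bound lets the squared step gained by descent absorb the noise; it contains (1-p)/p,
  which for the chosen p is exactly max{d/\<zeta> - 1, m/b}.\<close>

lemma grad_eqI:
  fixes h :: "real ^ 'd \<Rightarrow> real"
  assumes "GDERIV h x :> D"
  shows "grad h x = D"
proof -
  have "h differentiable (at x)"
    using assms by (auto simp: gderiv_def differentiable_def)
  then have "GDERIV h x :> grad h x"
    by (rule GDERIV_grad)
  with assms show ?thesis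
    using has_derivative_unique by (metis gderiv_def vector_eq_ldot)
qed

lemma GDERIV_mean:
  fixes h :: "nat \<Rightarrow> real ^ 'd \<Rightarrow> real"
  assumes "\<And>i. i \<in> I \<Longrightarrow> GDERIV (h i) x :> D i"
  shows "GDERIV (\<lambda>x. r * (\<Sum>i\<in>I. h i x)) x :> r *\<^sub>R (\<Sum>i\<in>I. D i)"
proof -
  have "((\<lambda>x. r * (\<Sum>i\<in>I. h i x)) has_derivative (\<lambda>y. r * (\<Sum>i\<in>I. y \<bullet> D i))) (at x)"
    using assms unfolding gderiv_def
    by (intro has_derivative_mult_right has_derivative_sum) auto
  then show ?thesis
    by (simp add: gderiv_def inner_sum_right)
qed

lemma GDERIV_line:
  fixes h :: "real ^ 'd \<Rightarrow> real"
  assumes "GDERIV h (x + t *\<^sub>R v) :> D"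
  shows "((\<lambda>s. h (x + s *\<^sub>R v)) has_real_derivative D \<bullet> v) (at t)"
proof -
  have "((\<lambda>s. x + s *\<^sub>R v) has_derivative (\<lambda>s. s *\<^sub>R v)) (at t)"
    by (auto intro!: derivative_eq_intros)
  from has_derivative_compose[OF this assms[unfolded gderiv_def]] show ?thesis
    by (rule has_derivative_imp_has_field_derivative) (simp add: inner_commute)
qed

text \<open>Only the averages \<open>local_obj m f i\<close> are assumed to have Lipschitz
  gradients; a single component is merely differentiable and its gradient may be discontinuous. Each
  coordinate is still a pointwise limit of difference quotients of a continuous function.\<close>

lemma borel_measurable_grad:
  fixes h :: "real ^ 'd \<Rightarrow> real"
  assumes "\<And>x. h differentiable (at x)"
  shows "grad h \<in> borel_measurable borel"
proof (rule borel_measurable_euclidean_space[THEN iffD2], intro ballI)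
  fix e :: "real ^ 'd" assume "e \<in> Basis"
  have cont: "continuous_on UNIV h"
    using assms differentiable_imp_continuous_within by (auto simp: continuous_on_eq_continuous_within)
  then have [measurable]: "h \<in> borel_measurable borel"
    by (rule borel_measurable_continuous_onI)
  let ?q = "\<lambda>k x. (h (x + (1 / real (Suc k)) *\<^sub>R e) - h x) * real (Suc k)"
  show "(\<lambda>x. grad h x \<bullet> e) \<in> borel_measurable borel"
  proof (rule borel_measurable_LIMSEQ_real)
    fix x :: "real ^ 'd"
    have "DERIV (\<lambda>t. h (x + t *\<^sub>R e)) 0 :> grad h x \<bullet> e"
      using GDERIV_grad[OF assms, of x] by (intro GDERIV_line) simp
    then have "(\<lambda>t. (h (x + t *\<^sub>R e) - h x) / t) \<midarrow>0\<rightarrow> grad h x \<bullet> e"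
      by (simp add: DERIV_def)
    moreover have "filterlim (\<lambda>k. 1 / real (Suc k)) (at 0) sequentially"
      using LIMSEQ_inverse_real_of_nat by (simp add: filterlim_at inverse_eq_divide)
    ultimately have "(\<lambda>k. (h (x + (1 / real (Suc k)) *\<^sub>R e) - h x) / (1 / real (Suc k)))
        \<longlonglongrightarrow> grad h x \<bullet> e"
      by (rule filterlim_compose)
    then show "(\<lambda>k. ?q k x) \<longlonglongrightarrow> grad h x \<bullet> e"
      by simp
  qed measurable
qed

text \<open>Up to the constant \<open>h x\<close>, the auxiliary \<open>\<phi>\<close> is h on the
  segment minus its quadratic upper model. The Lipschitz bound makes its derivative nonpositive, so
  no line integral of the gradient is needed.\<close>

lemma smooth_descent:
  fixes h :: "real ^ 'd \<Rightarrow> real"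
  assumes diff: "\<And>x. GDERIV h x :> grad h x"
    and lip: "\<And>x y. norm (grad h x - grad h y) \<le> L * norm (x - y)"
  shows "h y \<le> h x + grad h x \<bullet> (y - x) + L / 2 * (norm (y - x))\<^sup>2"
proof -
  define v where "v = y - x"
  define \<phi> where "\<phi> t = h (x + t *\<^sub>R v) - t * (grad h x \<bullet> v) - L / 2 * t\<^sup>2 * (norm v)\<^sup>2" for t
  have "\<phi> 1 \<le> \<phi> 0"
  proof (rule DERIV_nonpos_imp_nonincreasing[where f = \<phi> and a = 0 and b = 1])
    fix t :: real assume t: "0 \<le> t" "t \<le> 1"
    let ?D = "grad h (x + t *\<^sub>R v) \<bullet> v - grad h x \<bullet> v - L * t * (norm v)\<^sup>2"
    have "((\<lambda>t. h (x + t *\<^sub>R v)) has_real_derivative grad h (x + t *\<^sub>R v) \<bullet> v) (at t)"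
      using diff by (rule GDERIV_line)
    then have "(\<phi> has_real_derivative ?D) (at t)"
      unfolding \<phi>_def by (auto intro!: derivative_eq_intros)
    moreover have "?D \<le> 0"
    proof -
      have "(grad h (x + t *\<^sub>R v) - grad h x) \<bullet> v \<le> norm (grad h (x + t *\<^sub>R v) - grad h x) * norm v"
        by (rule norm_cauchy_schwarz)
      also have "\<dots> \<le> (L * norm (t *\<^sub>R v)) * norm v"
        using lip[of "x + t *\<^sub>R v" x] by (intro mult_right_mono) auto
      also have "\<dots> = L * t * (norm v)\<^sup>2"
        using t by (simp add: power2_eq_square)
      finally show ?thesis by (simp add: inner_diff_left)
    qed
    ultimately show "\<exists>D. (\<phi> has_real_derivative D) (at t) \<and> D \<le> 0" by blast
  qed simp
  then show ?thesis by (simp add: \<phi>_def v_def)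
qed

lemma norm_mean_power2_le:
  fixes v :: "nat \<Rightarrow> 'a::real_inner"
  shows "(norm ((1 / real n) *\<^sub>R (\<Sum>i=1..n. v i)))\<^sup>2 \<le> (1 / real n) * (\<Sum>i=1..n. (norm (v i))\<^sup>2)"
proof (cases "n = 0")
  case False
  have "norm (\<Sum>i=1..n. v i) \<le> (\<Sum>i=1..n. norm (v i))"
    by (rule norm_sum)
  then have "(norm (\<Sum>i=1..n. v i))\<^sup>2 \<le> (\<Sum>i=1..n. norm (v i))\<^sup>2"
    by (intro power_mono) auto
  also have "\<dots> \<le> real n * (\<Sum>i=1..n. (norm (v i))\<^sup>2)"
    using sum_squared_le_sum_of_squares[of "\<lambda>i. norm (v i)" "{1..n}"] by (simp add: mult.commute)
  finally show ?thesis
    using False by (simp add: power_mult_distrib divide_simps power2_eq_square mult.commute)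
qed simp

section \<open>Independent sub-sigma-algebras\<close>

lemma nn_integral_cmult_real:
  assumes "0 \<le> r" "h \<in> borel_measurable M"
  shows "(\<integral>\<^sup>+s. ennreal (r * h s) \<partial>M) = ennreal r * (\<integral>\<^sup>+s. ennreal (h s) \<partial>M)"
  using assms by (simp add: ennreal_mult' nn_integral_cmult)

context prob_space
begin

text \<open>Freezing: the identity map, viewed into \<open>A\<close> and into \<open>B\<close>,
  gives two independent random variables. The law of the diagonal pair is therefore a product, and
  Tonelli's theorem applies.\<close>

lemma nn_integral_indep_diagonal:
  assumes A: "subalgebra M A" and B: "subalgebra M B"
    and indep: "indep_set (sets A) (sets B)"
    and \<Psi>: "\<Psi> \<in> borel_measurable (A \<Otimes>\<^sub>M B)"
  shows "(\<integral>\<^sup>+s. \<Psi> (s, s) \<partial>M) = (\<integral>\<^sup>+s. \<integral>\<^sup>+s'. \<Psi> (s, s') \<partial>M \<partial>M)"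
proof -
  have mA: "(\<lambda>s. s) \<in> M \<rightarrow>\<^sub>M A" and mB: "(\<lambda>s. s) \<in> M \<rightarrow>\<^sub>M B"
    using A B by (auto simp: subalgebra_def measurable_def intro!: sets.Int)
  \<comment> \<open>The identity map generates exactly its target sub-sigma-algebra, so independence
    of the two maps is the assumed independence of \<open>A\<close> and \<open>B\<close>.\<close>
  have vim: "sigma_sets (space M) {(\<lambda>s. s) -` X \<inter> space M | X. X \<in> sets G} = sets G"
    if "subalgebra M G" for G
  proof -
    have "{(\<lambda>s. s) -` X \<inter> space M | X. X \<in> sets G} = sets G"
      using that sets.sets_into_space[of _ G] by (fastforce simp: subalgebra_def)
    then show ?thesis
      using that sets.sigma_sets_eq[of G] by (simp add: subalgebra_def)
  qed
  have "indep_var A (\<lambda>s. s) B (\<lambda>s. s)"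
    unfolding indep_var_eq vim[OF A] vim[OF B] using indep mA mB by blast
  then have eq: "distr M A (\<lambda>s. s) \<Otimes>\<^sub>M distr M B (\<lambda>s. s) = distr M (A \<Otimes>\<^sub>M B) (\<lambda>s. (s, s))"
    by (simp add: indep_var_distribution_eq)
  interpret DB: prob_space "distr M B (\<lambda>s. s)" by (rule prob_space_distr[OF mB])
  have [measurable]: "(\<lambda>s. (s, s)) \<in> M \<rightarrow>\<^sub>M A \<Otimes>\<^sub>M B"
    using mA mB by (rule measurable_Pair)
  have "(\<integral>\<^sup>+s. \<Psi> (s, s) \<partial>M) = (\<integral>\<^sup>+z. \<Psi> z \<partial>distr M (A \<Otimes>\<^sub>M B) (\<lambda>s. (s, s)))"
    using \<Psi> by (simp add: nn_integral_distr)
  also have "\<dots> = (\<integral>\<^sup>+s. \<integral>\<^sup>+s'. \<Psi> (s, s') \<partial>distr M B (\<lambda>s. s) \<partial>distr M A (\<lambda>s. s))"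
    unfolding eq[symmetric] using \<Psi> by (subst DB.nn_integral_fst[symmetric]) auto
  also have "\<dots> = (\<integral>\<^sup>+s. \<integral>\<^sup>+s'. \<Psi> (s, s') \<partial>distr M B (\<lambda>s. s) \<partial>M)"
  proof -
    have "(\<lambda>s. \<integral>\<^sup>+s'. \<Psi> (s, s') \<partial>distr M B (\<lambda>s. s)) \<in> borel_measurable A"
      using \<Psi> by (intro DB.borel_measurable_nn_integral) (simp add: split_beta')
    then show ?thesis
      by (simp add: nn_integral_distr[OF mA])
  qed
  also have "\<dots> = (\<integral>\<^sup>+s. \<integral>\<^sup>+s'. \<Psi> (s, s') \<partial>M \<partial>M)"
  proof (rule nn_integral_cong)
    fix s assume "s \<in> space M"
    then have "s \<in> space A" using A by (simp add: subalgebra_def)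
    then have "(\<lambda>s'. \<Psi> (s, s')) \<in> borel_measurable B"
      using \<Psi> by simp
    then show "(\<integral>\<^sup>+s'. \<Psi> (s, s') \<partial>distr M B (\<lambda>s. s)) = (\<integral>\<^sup>+s'. \<Psi> (s, s') \<partial>M)"
      by (intro nn_integral_distr[OF mB]) auto
  qed
  finally show ?thesis .
qed

text \<open>The cross term is linear in \<open>D\<close> and integrates to 0. The finite bound
  \<open>sq\<close> allows this computation to be done in the reals and carried back to extended
  values.\<close>

lemma nn_integral_add_centered:
  fixes a :: "'b::euclidean_space" and D :: "'a \<Rightarrow> 'b"
  assumes D: "integrable M D" "(\<integral>s. D s \<partial>M) = 0"
    and sq: "(\<integral>\<^sup>+s. ennreal ((norm (D s))\<^sup>2) \<partial>M) \<le> ennreal v"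
  shows "(\<integral>\<^sup>+s. ennreal ((norm (a + D s))\<^sup>2) \<partial>M) \<le> ennreal ((norm a)\<^sup>2) + ennreal v"
proof -
  have [measurable]: "D \<in> borel_measurable M" using D by auto
  have int: "integrable M (\<lambda>s. (norm (D s))\<^sup>2)"
    using sq by (intro integrableI_bounded) (auto simp: le_less_trans)
  have eq: "(norm (a + D s))\<^sup>2 = (norm a)\<^sup>2 + 2 * (a \<bullet> D s) + (norm (D s))\<^sup>2" for s
    by (simp add: power2_norm_eq_inner inner_add inner_commute)
  have "integrable M (\<lambda>s. a \<bullet> D s)" using D by simp
  then have "(\<integral>s. (norm (a + D s))\<^sup>2 \<partial>M) = (norm a)\<^sup>2 + (\<integral>s. (norm (D s))\<^sup>2 \<partial>M)"
    and int': "integrable M (\<lambda>s. (norm (a + D s))\<^sup>2)"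
    unfolding eq using D int by (auto simp: prob_space)
  then have "(\<integral>\<^sup>+s. ennreal ((norm (a + D s))\<^sup>2) \<partial>M)
      = ennreal ((norm a)\<^sup>2) + (\<integral>\<^sup>+s. ennreal ((norm (D s))\<^sup>2) \<partial>M)"
    using int by (simp add: nn_integral_eq_integral ennreal_plus)
  with sq show ?thesis by (simp add: add_left_mono)
qed

lemma nn_integral_add_noise:
  fixes a :: "'a \<Rightarrow> 'b::euclidean_space" and D :: "'a \<Rightarrow> 'a \<Rightarrow> 'b"
  assumes A: "subalgebra M A" and B: "subalgebra M B"
    and indep: "indep_set (sets A) (sets B)"
    and a [measurable]: "a \<in> borel_measurable A"
    and D [measurable]: "(\<lambda>(s, s'). D s s') \<in> borel_measurable (A \<Otimes>\<^sub>M B)"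
    and v [measurable]: "v \<in> borel_measurable M"
    and centered: "AE s in M. integrable M (D s) \<and> (\<integral>s'. D s s' \<partial>M) = 0"
    and sq: "AE s in M. (\<integral>\<^sup>+s'. ennreal ((norm (D s s'))\<^sup>2) \<partial>M) \<le> ennreal (v s)"
  shows "(\<integral>\<^sup>+s. ennreal ((norm (a s + D s s))\<^sup>2) \<partial>M)
      \<le> (\<integral>\<^sup>+s. ennreal ((norm (a s))\<^sup>2) \<partial>M) + (\<integral>\<^sup>+s. ennreal (v s) \<partial>M)"
proof -
  have aM [measurable]: "a \<in> borel_measurable M"
    using measurable_from_subalg[OF A a] .
  have "(\<lambda>z. ennreal ((norm (a (fst z) + D (fst z) (snd z)))\<^sup>2)) \<in> borel_measurable (A \<Otimes>\<^sub>M B)"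
    using D by (simp add: split_beta')
  from nn_integral_indep_diagonal[OF A B indep this]
  have "(\<integral>\<^sup>+s. ennreal ((norm (a s + D s s))\<^sup>2) \<partial>M)
      = (\<integral>\<^sup>+s. \<integral>\<^sup>+s'. ennreal ((norm (a s + D s s'))\<^sup>2) \<partial>M \<partial>M)" by simp
  also have "\<dots> \<le> (\<integral>\<^sup>+s. ennreal ((norm (a s))\<^sup>2) + ennreal (v s) \<partial>M)"
    using centered sq
    by (intro nn_integral_mono_AE) (auto intro!: nn_integral_add_centered)
  also have "\<dots> = (\<integral>\<^sup>+s. ennreal ((norm (a s))\<^sup>2) \<partial>M) + (\<integral>\<^sup>+s. ennreal (v s) \<partial>M)"
    by (rule nn_integral_add) auto
  finally show ?thesis .
qed

text \<open>Translates hypotheses stated with conditional expectations into frozen integrals: the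
  right-hand side is \<open>A\<close>-measurable and, by freezing, has the correct integral over
  every set of \<open>A\<close>.\<close>

lemma nn_cond_exp_indep_diagonal:
  assumes A: "subalgebra M A" and B: "subalgebra M B"
    and indep: "indep_set (sets A) (sets B)"
    and \<Psi>: "\<Psi> \<in> borel_measurable (A \<Otimes>\<^sub>M B)"
  shows "AE s in M. nn_cond_exp M A (\<lambda>s. \<Psi> (s, s)) s = (\<integral>\<^sup>+s'. \<Psi> (s, s') \<partial>M)"
proof -
  interpret finite_measure_subalgebra M A
    using A by unfold_locales
  have mA: "(\<lambda>s. s) \<in> M \<rightarrow>\<^sub>M A" and mB: "(\<lambda>s. s) \<in> M \<rightarrow>\<^sub>M B"
    using A B by (auto simp: subalgebra_def measurable_def intro!: sets.Int)
  have \<Psi>': "(\<lambda>z. \<Psi> (fst z, snd z)) \<in> borel_measurable (A \<Otimes>\<^sub>M M)"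
  proof -
    have "(\<lambda>z. (fst z, snd z)) \<in> A \<Otimes>\<^sub>M M \<rightarrow>\<^sub>M A \<Otimes>\<^sub>M B"
      using mB by (intro measurable_Pair) (auto intro: measurable_compose[OF measurable_snd])
    then show ?thesis using \<Psi> by (rule measurable_compose)
  qed
  have "AE s in M. (\<integral>\<^sup>+s'. \<Psi> (s, s') \<partial>M) = nn_cond_exp M A (\<lambda>s. \<Psi> (s, s)) s"
  proof (rule nn_cond_exp_charact)
    show "(\<lambda>s. \<integral>\<^sup>+s'. \<Psi> (s, s') \<partial>M) \<in> borel_measurable A"
      using \<Psi>' by (intro borel_measurable_nn_integral) (simp add: split_beta')
    show "random_variable borel (\<lambda>s. \<Psi> (s, s))"
      using mA mB \<Psi> by (intro measurable_compose[OF measurable_Pair]) auto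
    fix X assume [measurable]: "X \<in> sets A"
    have "(\<lambda>z. \<Psi> z * indicator X (fst z)) \<in> borel_measurable (A \<Otimes>\<^sub>M B)"
      using \<Psi> by measurable
    from nn_integral_indep_diagonal[OF A B indep this]
    have "(\<integral>\<^sup>+s\<in>X. \<Psi> (s, s) \<partial>M) = (\<integral>\<^sup>+s. \<integral>\<^sup>+s'. \<Psi> (s, s') * indicator X s \<partial>M \<partial>M)" by simp
    also have "\<dots> = (\<integral>\<^sup>+s\<in>X. (\<integral>\<^sup>+s'. \<Psi> (s, s') \<partial>M) \<partial>M)"
      by (intro nn_integral_cong) (simp split: split_indicator)
    finally show "(\<integral>\<^sup>+s\<in>X. \<Psi> (s, s) \<partial>M) = (\<integral>\<^sup>+s\<in>X. (\<integral>\<^sup>+s'. \<Psi> (s, s') \<partial>M) \<partial>M)" .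
  qed
  then show ?thesis by (auto simp: eq_commute)
qed

text \<open>\<open>real_cond_exp\<close> is the difference of the conditional expectations of the
  positive and negative parts, so the nonnegative version applies to each. Integrability is asked of
  the sections only, because on the diagonal it would need moments of the iterates that are not yet
  available.\<close>

lemma real_cond_exp_indep_diagonal:
  assumes A: "subalgebra M A" and B: "subalgebra M B"
    and indep: "indep_set (sets A) (sets B)"
    and \<psi> [measurable]: "\<psi> \<in> borel_measurable (A \<Otimes>\<^sub>M B)"
    and int: "\<And>s. s \<in> space M \<Longrightarrow> integrable M (\<lambda>s'. \<psi> (s, s'))"
  shows "AE s in M. real_cond_exp M A (\<lambda>s. \<psi> (s, s)) s = (\<integral>s'. \<psi> (s, s') \<partial>M)"
proof -
  have "AE s in M. nn_cond_exp M A (\<lambda>s. ennreal (\<psi> (s, s))) s = (\<integral>\<^sup>+s'. ennreal (\<psi> (s, s')) \<partial>M)"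
    and "AE s in M. nn_cond_exp M A (\<lambda>s. ennreal (- \<psi> (s, s))) s = (\<integral>\<^sup>+s'. ennreal (- \<psi> (s, s')) \<partial>M)"
    using nn_cond_exp_indep_diagonal[OF A B indep, of "\<lambda>z. ennreal (\<psi> z)"]
      nn_cond_exp_indep_diagonal[OF A B indep, of "\<lambda>z. ennreal (- \<psi> z)"] by auto
  with AE_space show ?thesis
  proof eventually_elim
    case (elim s)
    then show ?case
      using real_lebesgue_integral_def[OF int[of s]] by (simp add: real_cond_exp_def)
  qed
qed

end

section \<open>Quantization\<close>

lemma l0norm_le_CARD: "l0norm (y :: real ^ 'd) \<le> CARD('d)"
  unfolding l0norm_def by (rule card_mono) auto

lemma l0norm_eq_0_iff: "l0norm (y :: real ^ 'd) = 0 \<longleftrightarrow> y = 0"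
  by (auto simp: l0norm_def vec_eq_iff)

lemma borel_measurable_l0norm [measurable]:
  "(\<lambda>y :: real ^ 'd. real (l0norm y)) \<in> borel_measurable borel"
proof -
  have eq: "real (l0norm y) = (\<Sum>e\<in>UNIV. if y $ e \<noteq> 0 then 1 else 0)" for y :: "real ^ 'd"
    by (simp add: l0norm_def sum.If_cases)
  have [measurable]: "(\<lambda>y :: real ^ 'd. y $ e) \<in> borel_measurable borel" for e
    by (intro borel_measurable_continuous_onI continuous_intros)
  show ?thesis unfolding eq by measurable
qed

text \<open>The supremum is finite since at most d components are non-zero. Positivity comes from
  unbiasedness: with density 0 the vector \<open>Q u 1\<close> would vanish almost surely, yet its
  mean is the non-zero vector 1. Positivity is what yields p > 0 and makes d/\<zeta>
  meaningful.\<close>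

lemma
  fixes Q :: "'u \<Rightarrow> real ^ 'd \<Rightarrow> real ^ 'd"
  assumes quant: "quantization U Q \<omega>"
  shows expected_l0norm_le_density: "(\<integral>\<^sup>+u. ennreal (real (l0norm (Q u x))) \<partial>U) \<le> ennreal (expected_density U Q)"
    and expected_density_le_CARD: "expected_density U Q \<le> real CARD('d)"
    and expected_density_pos: "0 < expected_density U Q"
proof -
  interpret U: prob_space U using quant by (simp add: quantization_def)
  have Q [measurable]: "(\<lambda>u. Q u x) \<in> borel_measurable U" for x
    using quant by (auto simp: quantization_def)
  have int: "integrable U (\<lambda>u. real (l0norm (Q u x)))" for x
    by (rule U.integrable_const_bound[where B = "real CARD('d)"]) (auto simp: l0norm_le_CARD)
  have le: "(\<integral>u. real (l0norm (Q u x)) \<partial>U) \<le> real CARD('d)" for x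
    by (rule U.integral_le_const[OF int]) (simp add: l0norm_le_CARD)
  then have bdd: "bdd_above (range (\<lambda>x. \<integral>u. real (l0norm (Q u x)) \<partial>U))"
    by (intro bdd_aboveI2)
  have upper: "(\<integral>u. real (l0norm (Q u x)) \<partial>U) \<le> expected_density U Q" for x
    unfolding expected_density_def by (rule cSUP_upper[OF _ bdd]) simp
  show "(\<integral>\<^sup>+u. ennreal (real (l0norm (Q u x))) \<partial>U) \<le> ennreal (expected_density U Q)"
    using upper[of x] by (simp add: nn_integral_eq_integral int ennreal_leI)
  show "expected_density U Q \<le> real CARD('d)"
    unfolding expected_density_def by (rule cSUP_least) (auto simp: le)
  show "0 < expected_density U Q"
  proof (rule ccontr)
    assume "\<not> 0 < expected_density U Q"
    then have "(\<integral>u. real (l0norm (Q u 1)) \<partial>U) = 0"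
      using upper[of 1] by (intro antisym) auto
    then have "AE u in U. Q u 1 = 0"
      using integral_nonneg_eq_0_iff_AE[OF int[of 1]] by (simp add: l0norm_eq_0_iff)
    then have "(\<integral>u. Q u 1 \<partial>U) = (\<integral>u. 0 \<partial>U)"
      by (intro integral_cong_AE) auto
    then show False using quant by (auto simp: quantization_def)
  qed
qed

section \<open>Minibatch gradient differences\<close>

lemma borel_measurable_minibatch_diff:
  fixes f :: "nat \<Rightarrow> nat \<Rightarrow> real ^ 'd \<Rightarrow> real"
  assumes diff: "\<And>j y. j \<in> {1..m} \<Longrightarrow> f i j differentiable (at y)"
    and A: "A \<in> N \<rightarrow>\<^sub>M count_space {A. A \<subseteq> {1..m} \<and> card A = b}"
    and [measurable]: "X \<in> borel_measurable N" "Y \<in> borel_measurable N"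
  shows "(\<lambda>z. minibatch_diff b f i (A z) (X z) (Y z)) \<in> borel_measurable N"
proof -
  have sub: "A z \<subseteq> {1..m}" if "z \<in> space N" for z
    using measurable_space[OF A that] by simp
  have [measurable]: "grad (f i j) \<in> borel_measurable borel" if "j \<in> {1..m}" for j
    by (rule borel_measurable_grad) (rule diff[OF that])
  have [measurable]: "Measurable.pred N (\<lambda>z. j \<in> A z)" for j
    using measurable_compose[OF A, of "\<lambda>A. j \<in> A" "count_space UNIV"] by simp
  \<comment> \<open>The sum over a random index set becomes a sum over the fixed range
    \<open>{1..m}\<close> with conditional terms, each of them measurable.\<close>
  have "(\<lambda>z. (1 / real b) *\<^sub>R (\<Sum>j=1..m. if j \<in> A z then grad (f i j) (Y z) - grad (f i j) (X z) else 0))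
      \<in> borel_measurable N"
    by measurable
  also have "?this \<longleftrightarrow> ?thesis"
  proof (rule measurable_cong)
    fix z assume "z \<in> space N"
    from sub[OF this] show "(1 / real b) *\<^sub>R (\<Sum>j=1..m. if j \<in> A z then grad (f i j) (Y z) - grad (f i j) (X z) else 0)
      = minibatch_diff b f i (A z) (X z) (Y z)"
      by (simp add: minibatch_diff_def sum.If_cases Int_absorb1)
  qed
  finally show ?thesis .
qed

text \<open>The bound does not involve the minibatch: at fixed points the minibatch difference is a
  bounded random vector, hence integrable.\<close>

lemma norm_minibatch_diff_le:
  assumes "A \<subseteq> {1..m}"
  shows "norm (minibatch_diff b f i A x y) \<le> (1 / real b) * (\<Sum>j=1..m. norm (grad (f i j) y - grad (f i j) x))"
proof -
  have "norm (\<Sum>j\<in>A. grad (f i j) y - grad (f i j) x) \<le> (\<Sum>j\<in>A. norm (grad (f i j) y - grad (f i j) x))"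
    by (rule norm_sum)
  also have "\<dots> \<le> (\<Sum>j=1..m. norm (grad (f i j) y - grad (f i j) x))"
    using assms by (intro sum_mono2) auto
  finally show ?thesis
    by (simp add: minibatch_diff_def divide_right_mono)
qed

section \<open>Runs of VR-MARINA\<close>

text \<open>The PL inequality, the lower bound on the objective and the stepsize conditions appear
  only as premises of the contraction lemmas; here \<open>p\<close> is any number strictly between 0
  and 1.\<close>

locale vr_marina = prob_space M
  for M :: "'s measure" +
  fixes U :: "'u measure" and n m b :: nat and p \<omega> \<gamma> :: real
    and f :: "nat \<Rightarrow> nat \<Rightarrow> real ^ 'd \<Rightarrow> real"
    and Lw \<L>w :: "nat \<Rightarrow> real"
    and Q :: "'u \<Rightarrow> real ^ 'd \<Rightarrow> real ^ 'd"
    and c :: "nat \<Rightarrow> 's \<Rightarrow> bool"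
    and S :: "nat \<Rightarrow> nat \<Rightarrow> 's \<Rightarrow> nat set"
    and \<xi> :: "nat \<Rightarrow> nat \<Rightarrow> 's \<Rightarrow> 'u"
    and x0 :: "real ^ 'd"
    and x g :: "nat \<Rightarrow> 's \<Rightarrow> real ^ 'd"
  assumes dims: "n \<ge> 1" "m \<ge> 1" "b \<ge> 1"
    and p01: "0 < p" "p < 1"
    and diff: "\<And>i j y. i \<in> {1..n} \<Longrightarrow> j \<in> {1..m} \<Longrightarrow> f i j differentiable (at y)"
    and smooth: "\<And>i y z. i \<in> {1..n} \<Longrightarrow>
        norm (grad (local_obj m f i) y - grad (local_obj m f i) z) \<le> Lw i * norm (y - z)"
    and quant: "quantization U Q \<omega>"
    and sampling: "vr_marina_sampling M U n m b p c S \<xi>"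
    and run: "\<And>s. s \<in> space M \<Longrightarrow>
        vr_marina_run n m b f \<gamma> x0 (\<lambda>k. c k s) (\<lambda>i k. S i k s) (\<lambda>i k. Q (\<xi> i k s))
          (\<lambda>k. x k s) (\<lambda>k. g k s)"
    and avg_smooth: "average_smooth M n m b f S x \<L>w"
begin

abbreviation "F \<equiv> global_obj n m f"

definition "L = sqrt ((1 / real n) * (\<Sum>i=1..n. (Lw i)\<^sup>2))"
definition "\<L> = sqrt ((1 / real n) * (\<Sum>i=1..n. (\<L>w i)\<^sup>2))"

subsection \<open>Smoothness of the objective\<close>

lemma GDERIV_local: "i \<in> {1..n} \<Longrightarrow> GDERIV (local_obj m f i) y :> grad (local_obj m f i) y"
proof -
  assume i: "i \<in> {1..n}"
  have "GDERIV (local_obj m f i) y :> (1 / real m) *\<^sub>R (\<Sum>j=1..m. grad (f i j) y)"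
    unfolding local_obj_def[abs_def] using i by (intro GDERIV_mean GDERIV_grad diff)
  then show ?thesis by (simp add: grad_eqI)
qed

lemma grad_F: "grad F y = (1 / real n) *\<^sub>R (\<Sum>i=1..n. grad (local_obj m f i) y)"
  and GDERIV_F: "GDERIV F y :> grad F y"
proof -
  have "GDERIV F y :> (1 / real n) *\<^sub>R (\<Sum>i=1..n. grad (local_obj m f i) y)"
    unfolding global_obj_def[abs_def] by (intro GDERIV_mean GDERIV_local)
  then show "grad F y = (1 / real n) *\<^sub>R (\<Sum>i=1..n. grad (local_obj m f i) y)"
    and "GDERIV F y :> grad F y" by (simp_all add: grad_eqI)
qed

lemma norm_grad_local_power2_le:
  assumes "i \<in> {1..n}"
  shows "(norm (grad (local_obj m f i) y - grad (local_obj m f i) z))\<^sup>2 \<le> (Lw i)\<^sup>2 * (norm (y - z))\<^sup>2"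
  using power_mono[OF smooth[OF assms], of y z 2] by (simp add: power_mult_distrib)

text \<open>Jensen's inequality over the workers, which is why \<open>L\<close> is the quadratic
  mean of the \<open>Lw i\<close>.\<close>

lemma F_smooth: "norm (grad F y - grad F z) \<le> L * norm (y - z)"
proof (rule power2_le_imp_le)
  have "(norm (grad F y - grad F z))\<^sup>2
      = (norm ((1 / real n) *\<^sub>R (\<Sum>i=1..n. grad (local_obj m f i) y - grad (local_obj m f i) z)))\<^sup>2"
    by (simp add: grad_F sum_subtractf scaleR_diff_right)
  also have "\<dots> \<le> (1 / real n) * (\<Sum>i=1..n. (norm (grad (local_obj m f i) y - grad (local_obj m f i) z))\<^sup>2)"
    by (rule norm_mean_power2_le)
  also have "\<dots> \<le> (1 / real n) * (\<Sum>i=1..n. (Lw i)\<^sup>2 * (norm (y - z))\<^sup>2)"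
    by (intro mult_left_mono sum_mono norm_grad_local_power2_le) auto
  also have "\<dots> = (L * norm (y - z))\<^sup>2"
    by (simp add: L_def power_mult_distrib sum_distrib_right sum_nonneg)
  finally show "(norm (grad F y - grad F z))\<^sup>2 \<le> (L * norm (y - z))\<^sup>2" .
  show "0 \<le> L * norm (y - z)"
    by (simp add: L_def sum_nonneg)
qed

lemma borel_measurable_F [measurable]: "F \<in> borel_measurable borel"
proof (intro borel_measurable_continuous_onI continuous_at_imp_continuous_on ballI)
  show "isCont F y" for y
    using GDERIV_F[of y] unfolding gderiv_def by (rule has_derivative_continuous)
qed

lemma borel_measurable_grad_F [measurable]: "grad F \<in> borel_measurable borel"
  using GDERIV_F by (intro borel_measurable_grad) (auto simp: gderiv_def differentiable_def)

lemma borel_measurable_grad_local: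
  "i \<in> {1..n} \<Longrightarrow> grad (local_obj m f i) \<in> borel_measurable borel"
  using GDERIV_local by (intro borel_measurable_grad) (auto simp: gderiv_def differentiable_def)

subsection \<open>The sigma-algebras generated by samples\<close>

definition samples :: "sample set" where
  "samples = {Coin k | k. True} \<union> {Batch i k | i k. i \<in> {1..n}} \<union> {Seed i k | i k. i \<in> {1..n}}"

definition sample_events :: "sample \<Rightarrow> 's set set" where
  "sample_events t = (case t of
      Coin k \<Rightarrow> sets (vimage_algebra (space M) (c k) (count_space UNIV))
    | Batch i k \<Rightarrow> sets (vimage_algebra (space M) (S i k) (count_space {A. A \<subseteq> {1..m} \<and> card A = b}))
    | Seed i k \<Rightarrow> sets (vimage_algebra (space M) (\<xi> i k) U))"

text \<open>The events determined by the samples listed in \<open>I\<close>. Independence questions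
  thereby reduce to disjointness of sets of sample names.\<close>

definition alg :: "sample set \<Rightarrow> 's measure" where
  "alg I = sigma (space M) (\<Union>t\<in>I. sample_events t)"

text \<open>The samples of the iterations before k. They determine g^k and even x^{k+1}, so every
  sample of iteration k is fresh with respect to both points of the gradient difference.\<close>

definition past :: "nat \<Rightarrow> sample set" where
  "past k = {Coin l | l. l < k} \<union> {Batch i l | i l. i \<in> {1..n} \<and> l < k} \<union> {Seed i l | i l. i \<in> {1..n} \<and> l < k}"

lemma sample_events_Pow: "sample_events t \<subseteq> Pow (space M)"
  by (cases t; simp only: sample_events_def sample.case; metis sets.space_closed space_vimage_algebra)

lemma space_alg [simp]: "space (alg I) = space M"
  and sets_alg: "sets (alg I) = sigma_sets (space M) (\<Union>t\<in>I. sample_events t)"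
proof -
  have "(\<Union>t\<in>I. sample_events t) \<subseteq> Pow (space M)"
    using sample_events_Pow by auto
  then show "space (alg I) = space M" "sets (alg I) = sigma_sets (space M) (\<Union>t\<in>I. sample_events t)"
    by (simp_all add: alg_def space_measure_of sets_measure_of)
qed

lemma indep_samples: "indep_sets sample_events samples"
  using sampling unfolding vr_marina_sampling_def sample_events_def[abs_def] samples_def by blast

lemma subalgebra_alg:
  assumes "I \<subseteq> samples"
  shows "subalgebra M (alg I)"
  unfolding subalgebra_def sets_alg
proof (intro conjI sets.sigma_sets_subset)
  have "sample_events t \<subseteq> events" if "t \<in> samples" for t
    using indep_samples that by (auto simp: indep_sets_def)
  then show "(\<Union>t\<in>I. sample_events t) \<subseteq> events"
    using assms by blast
qed simp

lemma subalgebra_alg_mono: "I \<subseteq> J \<Longrightarrow> subalgebra (alg J) (alg I)"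
  unfolding subalgebra_def sets_alg by (auto intro!: sigma_sets_mono')

lemma measurable_alg_mono: "X \<in> alg I \<rightarrow>\<^sub>M N \<Longrightarrow> I \<subseteq> J \<Longrightarrow> X \<in> alg J \<rightarrow>\<^sub>M N"
  using measurable_from_subalg[OF subalgebra_alg_mono] .

lemma Int_stable_sample_events: "Int_stable (sample_events t)"
  by (cases t) (simp_all only: sample_events_def sample.case sets.Int_stable)

text \<open>Independent families remain independent when grouped over disjoint blocks, since each
  family is closed under intersection.\<close>

lemma indep_alg:
  assumes "I \<subseteq> samples" "J \<subseteq> samples" "I \<inter> J = {}"
  shows "indep_set (sets (alg I)) (sets (alg J))"
proof -
  have "indep_sets (\<lambda>z. sigma_sets (space M) (\<Union>t\<in>case_bool I J z. sample_events t)) UNIV"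
  proof (rule indep_sets_collect_sigma)
    show "indep_sets sample_events (\<Union>z\<in>UNIV. case_bool I J z)"
      by (rule indep_sets_mono_index[OF _ indep_samples]) (use assms in \<open>auto split: bool.splits\<close>)
    show "disjoint_family_on (case_bool I J) UNIV"
      using assms by (auto simp: disjoint_family_on_def split: bool.split)
  qed (rule Int_stable_sample_events)
  also have "(\<lambda>z. sigma_sets (space M) (\<Union>t\<in>case_bool I J z. sample_events t))
      = case_bool (sets (alg I)) (sets (alg J))"
    by (intro ext) (simp add: sets_alg split: bool.split)
  finally show ?thesis
    by (simp add: indep_set_def)
qed

lemma measurable_sample:
  assumes "X \<in> M \<rightarrow>\<^sub>M N" "sets (vimage_algebra (space M) X N) = sample_events t" "t \<in> I"
  shows "X \<in> alg I \<rightarrow>\<^sub>M N"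
proof (rule measurableI)
  fix Y assume "Y \<in> sets N"
  then have "X -` Y \<inter> space M \<in> sample_events t"
    unfolding assms(2)[symmetric] by (rule in_vimage_algebra)
  with assms(3) show "X -` Y \<inter> space (alg I) \<in> sets (alg I)"
    by (auto simp: sets_alg)
qed (use assms in \<open>auto dest: measurable_space\<close>)

lemma coin_measurable: "Coin k \<in> I \<Longrightarrow> c k \<in> alg I \<rightarrow>\<^sub>M count_space UNIV"
  and batch_measurable:
    "i \<in> {1..n} \<Longrightarrow> Batch i k \<in> I \<Longrightarrow> S i k \<in> alg I \<rightarrow>\<^sub>M count_space {A. A \<subseteq> {1..m} \<and> card A = b}"
  and seed_measurable: "i \<in> {1..n} \<Longrightarrow> Seed i k \<in> I \<Longrightarrow> \<xi> i k \<in> alg I \<rightarrow>\<^sub>M U"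
proof -
  have "random_variable (count_space UNIV) (c k)"
    "i \<in> {1..n} \<Longrightarrow> random_variable (count_space {A. A \<subseteq> {1..m} \<and> card A = b}) (S i k)"
    "i \<in> {1..n} \<Longrightarrow> random_variable U (\<xi> i k)"
    using sampling unfolding vr_marina_sampling_def by blast+
  then show "Coin k \<in> I \<Longrightarrow> c k \<in> alg I \<rightarrow>\<^sub>M count_space UNIV"
    "i \<in> {1..n} \<Longrightarrow> Batch i k \<in> I \<Longrightarrow> S i k \<in> alg I \<rightarrow>\<^sub>M count_space {A. A \<subseteq> {1..m} \<and> card A = b}"
    "i \<in> {1..n} \<Longrightarrow> Seed i k \<in> I \<Longrightarrow> \<xi> i k \<in> alg I \<rightarrow>\<^sub>M U"
    by (simp_all only: sample_events_def sample.case measurable_sample[where t = "Coin k"]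
        measurable_sample[where t = "Batch i k"] measurable_sample[where t = "Seed i k"])
qed

lemma past_subset: "past k \<subseteq> samples" "past k \<subseteq> past (Suc k)"
  by (auto simp: past_def samples_def)

subsection \<open>Measurability of the iterates\<close>

text \<open>Without a full gradient all workers add the same g^k, so the mean over n \<ge> 1 workers
  returns it once; with a full gradient the local gradients average to
  \<open>grad F\<close>.\<close>

lemma x_0: "s \<in> space M \<Longrightarrow> x 0 s = x0"
  and g_0: "s \<in> space M \<Longrightarrow> g 0 s = grad F x0"
  and x_Suc: "s \<in> space M \<Longrightarrow> x (Suc k) s = x k s - \<gamma> *\<^sub>R g k s"
  and g_Suc: "s \<in> space M \<Longrightarrow> g (Suc k) s =
     (if c k s then grad F (x (Suc k) s)
      else g k s + (1 / real n) *\<^sub>R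
        (\<Sum>i=1..n. Q (\<xi> i k s) (minibatch_diff b f i (S i k s) (x k s) (x (Suc k) s))))"
  using run[of s] dims
  by (auto simp: vr_marina_run_def vr_marina_worker_def grad_F sum.distrib scaleR_add_right
        simp del: sum_constant simp: sum_constant_scaleR)

lemma minibatch_measurable:
  assumes "i \<in> {1..n}" "A \<in> N \<rightarrow>\<^sub>M count_space {A. A \<subseteq> {1..m} \<and> card A = b}"
    "X \<in> borel_measurable N" "Y \<in> borel_measurable N"
  shows "(\<lambda>z. minibatch_diff b f i (A z) (X z) (Y z)) \<in> borel_measurable N"
  using assms by (intro borel_measurable_minibatch_diff[where m = m]) (auto intro: diff)

lemma Q_measurable:
  assumes "Y \<in> N \<rightarrow>\<^sub>M U" "X \<in> borel_measurable N"
  shows "(\<lambda>z. Q (Y z) (X z)) \<in> borel_measurable N"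
proof -
  have "(\<lambda>(u, y). Q u y) \<in> borel_measurable (U \<Otimes>\<^sub>M borel)"
    using quant by (simp add: quantization_def)
  from measurable_compose[OF measurable_Pair[OF assms] this] show ?thesis by simp
qed

lemma iterates_measurable:
  "x k \<in> borel_measurable (alg (past k)) \<and> g k \<in> borel_measurable (alg (past k))"
proof (induction k)
  case 0
  have "(\<lambda>s. x0) \<in> borel_measurable (alg (past 0))" "(\<lambda>s. grad F x0) \<in> borel_measurable (alg (past 0))"
    by simp_all
  then show ?case
    using measurable_cong[of "alg (past 0)" "x 0" "\<lambda>_. x0"]
      measurable_cong[of "alg (past 0)" "g 0" "\<lambda>_. grad F x0"] by (simp add: x_0 g_0)
next
  case (Suc k)
  let ?A = "alg (past (Suc k))"
  have x' [measurable]: "x k \<in> borel_measurable ?A" and [measurable]: "g k \<in> borel_measurable ?A"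
    using Suc past_subset(2)[of k] by (blast intro: measurable_alg_mono)+
  have "(\<lambda>s. x k s - \<gamma> *\<^sub>R g k s) \<in> borel_measurable ?A" by measurable
  then have x [measurable]: "x (Suc k) \<in> borel_measurable ?A"
    using measurable_cong[of ?A "x (Suc k)" "\<lambda>s. x k s - \<gamma> *\<^sub>R g k s"] by (simp add: x_Suc)
  have [measurable]: "c k \<in> ?A \<rightarrow>\<^sub>M count_space UNIV"
    by (rule coin_measurable) (simp add: past_def)
  have [measurable]: "(\<lambda>s. Q (\<xi> i k s) (minibatch_diff b f i (S i k s) (x k s) (x (Suc k) s)))
      \<in> borel_measurable ?A" if "i \<in> {1..n}" for i
  proof -
    have "Batch i k \<in> past (Suc k)" "Seed i k \<in> past (Suc k)"
      using that by (auto simp: past_def)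
    with that x x' show ?thesis
      by (intro Q_measurable minibatch_measurable seed_measurable batch_measurable)
  qed
  have "(\<lambda>s. if c k s then grad F (x (Suc k) s)
      else g k s + (1 / real n) *\<^sub>R
        (\<Sum>i=1..n. Q (\<xi> i k s) (minibatch_diff b f i (S i k s) (x k s) (x (Suc k) s))))
      \<in> borel_measurable ?A" by measurable
  then have "g (Suc k) \<in> borel_measurable ?A"
    by (subst measurable_cong[OF g_Suc]) auto
  with x show ?case by blast
qed

lemma iterate_measurable:
  assumes "past k \<subseteq> I"
  shows "x k \<in> borel_measurable (alg I)" "g k \<in> borel_measurable (alg I)" "x (Suc k) \<in> borel_measurable (alg I)"
proof -
  show [measurable]: "x k \<in> borel_measurable (alg I)" "g k \<in> borel_measurable (alg I)"
    using iterates_measurable assms by (auto intro: measurable_alg_mono)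
  have "(\<lambda>s. x k s - \<gamma> *\<^sub>R g k s) \<in> borel_measurable (alg I)" by measurable
  then show "x (Suc k) \<in> borel_measurable (alg I)"
    by (subst measurable_cong[OF x_Suc]) auto
qed

lemma iterate_random_variable [measurable]:
  "random_variable borel (x k)" "random_variable borel (g k)"
  using iterates_measurable[of k] measurable_from_subalg[OF subalgebra_alg[OF past_subset(1)]] by blast+

subsection \<open>The noise of one iteration\<close>

definition gdiff :: "nat \<Rightarrow> nat \<Rightarrow> 's \<Rightarrow> real ^ 'd" where
  "gdiff i k s = grad (local_obj m f i) (x (Suc k) s) - grad (local_obj m f i) (x k s)"

text \<open>The iterates are taken at \<open>s\<close> and the fresh minibatch at \<open>s'\<close>: two arguments let Fubini's
  theorem separate the past from the new sample.\<close>

definition mdiff :: "nat \<Rightarrow> nat \<Rightarrow> 's \<Rightarrow> 's \<Rightarrow> real ^ 'd" where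
  "mdiff i k s s' = minibatch_diff b f i (S i k s') (x k s) (x (Suc k) s)"

definition sqstep :: "nat \<Rightarrow> 's \<Rightarrow> real" where
  "sqstep k s = (norm (x (Suc k) s - x k s))\<^sup>2"

lemma gdiff_measurable:
  "i \<in> {1..n} \<Longrightarrow> past k \<subseteq> I \<Longrightarrow> gdiff i k \<in> borel_measurable (alg I)"
  unfolding gdiff_def[abs_def]
  by (intro borel_measurable_diff measurable_compose[OF _ borel_measurable_grad_local] iterate_measurable)

lemma sqstep_measurable [measurable]: "random_variable borel (sqstep k)"
  unfolding sqstep_def[abs_def] by measurable

lemma mdiff_measurable:
  assumes "i \<in> {1..n}" "past k \<subseteq> I" "Batch i k \<in> J"
  shows "(\<lambda>(s, s'). mdiff i k s s') \<in> borel_measurable (alg I \<Otimes>\<^sub>M alg J)"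
  unfolding mdiff_def split_beta' using assms
  by (intro minibatch_measurable measurable_compose[OF measurable_snd]
      measurable_compose[OF measurable_fst] iterate_measurable batch_measurable)

lemma mdiff_diagonal_measurable:
  assumes "i \<in> {1..n}" "past k \<subseteq> I" "Batch i k \<in> I"
  shows "(\<lambda>s. mdiff i k s s) \<in> borel_measurable (alg I)"
  unfolding mdiff_def using assms
  by (intro minibatch_measurable iterate_measurable batch_measurable)

lemma S_subset: "i \<in> {1..n} \<Longrightarrow> s \<in> space M \<Longrightarrow> S i k s \<subseteq> {1..m}"
  using measurable_space[OF batch_measurable, of i k UNIV s] by simp

lemma sample_sets:
  "i \<in> {1..n} \<Longrightarrow> {Batch i k} \<subseteq> samples" "i \<in> {1..n} \<Longrightarrow> {Seed i k} \<subseteq> samples" "{Coin k} \<subseteq> samples"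
  by (auto simp: samples_def)

lemma integrable_mdiff:
  assumes "i \<in> {1..n}" "s \<in> space M"
  shows "integrable M (mdiff i k s)"
proof (rule integrable_const_bound)
  show "AE s' in M. norm (mdiff i k s s') \<le> (1 / real b) *
      (\<Sum>j=1..m. norm (grad (f i j) (x (Suc k) s) - grad (f i j) (x k s)))"
    unfolding mdiff_def by (intro AE_I2 norm_minibatch_diff_le S_subset assms)
  have "S i k \<in> M \<rightarrow>\<^sub>M count_space {A. A \<subseteq> {1..m} \<and> card A = b}"
    using assms batch_measurable[of i k "{Batch i k}"]
      measurable_from_subalg[OF subalgebra_alg[OF sample_sets(1)]] by blast
  then show "random_variable borel (mdiff i k s)"
    unfolding mdiff_def[abs_def] using assms by (intro minibatch_measurable) auto
qed

text \<open>The smoothness assumption in frozen form. The algebra \<open>G\<close> generated by the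
  two iterates lies in the algebra of the past, hence is independent of the minibatch, and both
  conditional expectations given \<open>G\<close> become integrals over \<open>s'\<close> alone. No
  trace of \<open>G\<close> remains, so the result can be combined with any larger past.\<close>

lemma minibatch_noise:
  assumes i: "i \<in> {1..n}"
  shows "AE s in M. (\<integral>s'. mdiff i k s s' \<partial>M) = gdiff i k s \<and>
    (\<integral>\<^sup>+s'. ennreal ((norm (mdiff i k s s' - gdiff i k s))\<^sup>2) \<partial>M) \<le> ennreal ((\<L>w i)\<^sup>2 / real b * sqstep k s)"
proof -
  let ?xx = "\<lambda>s. (x k s, x (Suc k) s)"
  define G where "G = vimage_algebra (space M) ?xx (borel \<Otimes>\<^sub>M borel)"
  let ?B = "alg {Batch i k}"
  have [simp]: "space G = space M" by (simp add: G_def)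
  have "?xx \<in> alg (past k) \<rightarrow>\<^sub>M borel \<Otimes>\<^sub>M borel"
    by (intro measurable_Pair iterate_measurable) auto
  then have sub: "sets G \<subseteq> sets (alg (past k))"
    unfolding G_def by (intro sets_image_in_sets) auto
  have G: "subalgebra M G"
    using sub subalgebra_alg[OF past_subset(1), of k] by (auto simp: subalgebra_def)
  have B: "subalgebra M ?B" by (intro subalgebra_alg sample_sets i)
  have "indep_set (sets (alg (past k))) (sets ?B)"
    by (intro indep_alg past_subset sample_sets i) (auto simp: past_def)
  then have indep: "indep_set (sets G) (sets ?B)"
    using sub unfolding indep_sets2_eq by blast
  have xx: "?xx \<in> G \<rightarrow>\<^sub>M borel \<Otimes>\<^sub>M borel"
    unfolding G_def by (rule measurable_vimage_algebra1) (simp add: space_pair_measure)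
  have x: "x k \<in> borel_measurable G" "x (Suc k) \<in> borel_measurable G"
    using measurable_compose[OF xx measurable_fst] measurable_compose[OF xx measurable_snd] by simp_all
  have [measurable]: "(\<lambda>z. mdiff i k (fst z) (snd z)) \<in> borel_measurable (G \<Otimes>\<^sub>M ?B)"
    unfolding mdiff_def using i x
    by (intro minibatch_measurable measurable_compose[OF measurable_snd]
        measurable_compose[OF measurable_fst] batch_measurable) auto
  have [measurable]: "gdiff i k \<in> borel_measurable G"
    unfolding gdiff_def[abs_def] using x i
    by (intro borel_measurable_diff measurable_compose[OF _ borel_measurable_grad_local])
  have [measurable]: "(\<lambda>y :: real ^ 'd. y $ e) \<in> borel_measurable borel" for e
    by (intro borel_measurable_continuous_onI continuous_intros)
  have int_e: "integrable M (\<lambda>s'. mdiff i k s s' $ e)"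
    and nth_e: "(\<integral>s'. mdiff i k s s' $ e \<partial>M) = (\<integral>s'. mdiff i k s s' \<partial>M) $ e"
    if "s \<in> space M" for s e
    using integrable_mdiff[OF i that, of k] integrable_bounded_linear[OF bounded_linear_vec_nth]
      integral_bounded_linear[OF bounded_linear_vec_nth] by blast+
  have avg: "\<forall>e. AE s in M. real_cond_exp M G (\<lambda>s. mdiff i k s s $ e) s = gdiff i k s $ e"
    "AE s in M. nn_cond_exp M G (\<lambda>s. ennreal ((norm (mdiff i k s s - gdiff i k s))\<^sup>2)) s
        \<le> ennreal ((\<L>w i)\<^sup>2 / real b * sqstep k s)"
    using avg_smooth i unfolding average_smooth_def Let_def G_def mdiff_def gdiff_def sqstep_def by blast+
  have "AE s in M. real_cond_exp M G (\<lambda>s. mdiff i k s s $ e) s = (\<integral>s'. mdiff i k s s' $ e \<partial>M)" for e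
    using real_cond_exp_indep_diagonal[OF G B indep, of "\<lambda>z. mdiff i k (fst z) (snd z) $ e"] int_e
    by simp
  \<comment> \<open>The finitely many coordinates allow the exceptional null sets to be merged,
    turning componentwise equations into a vector identity.\<close>
  then have "AE s in M. \<forall>e. real_cond_exp M G (\<lambda>s. mdiff i k s s $ e) s = (\<integral>s'. mdiff i k s s' $ e \<partial>M)"
    by (simp add: AE_all_countable)
  moreover have "AE s in M. \<forall>e. real_cond_exp M G (\<lambda>s. mdiff i k s s $ e) s = gdiff i k s $ e"
    using avg(1) by (simp add: AE_all_countable)
  ultimately have mean: "AE s in M. (\<integral>s'. mdiff i k s s' \<partial>M) = gdiff i k s"
    using AE_space by eventually_elim (simp add: vec_eq_iff nth_e)
  have "AE s in M. nn_cond_exp M G (\<lambda>s. ennreal ((norm (mdiff i k s s - gdiff i k s))\<^sup>2)) s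
      = (\<integral>\<^sup>+s'. ennreal ((norm (mdiff i k s s' - gdiff i k s))\<^sup>2) \<partial>M)"
    using nn_cond_exp_indep_diagonal[OF G B indep,
        of "\<lambda>z. ennreal ((norm (mdiff i k (fst z) (snd z) - gdiff i k (fst z)))\<^sup>2)"] by simp
  with avg(2) mean show ?thesis
    by eventually_elim simp
qed

lemma quantization_noise:
  assumes i: "i \<in> {1..n}"
  shows "integrable M (\<lambda>s. Q (\<xi> i k s) y)" "(\<integral>s. Q (\<xi> i k s) y \<partial>M) = y"
    "(\<integral>\<^sup>+s. ennreal ((norm (Q (\<xi> i k s) y - y))\<^sup>2) \<partial>M) \<le> ennreal (\<omega> * (norm y)\<^sup>2)"
    "(\<integral>\<^sup>+s. ennreal (real (l0norm (Q (\<xi> i k s) y))) \<partial>M) \<le> ennreal (expected_density U Q)"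
proof -
  have \<xi> [measurable]: "\<xi> i k \<in> M \<rightarrow>\<^sub>M U" and dist: "distr M U (\<xi> i k) = U"
    using sampling i unfolding vr_marina_sampling_def by blast+
  have int: "integrable U (\<lambda>u. Q u y)" "(\<integral>u. Q u y \<partial>U) = y"
    "integrable U (\<lambda>u. (norm (Q u y - y))\<^sup>2)" "(\<integral>u. (norm (Q u y - y))\<^sup>2 \<partial>U) \<le> \<omega> * (norm y)\<^sup>2"
    using quant by (auto simp: quantization_def)
  then have [measurable]: "(\<lambda>u. Q u y) \<in> borel_measurable U" by auto
  show "integrable M (\<lambda>s. Q (\<xi> i k s) y)"
    using int(1) integrable_distr_eq[OF \<xi>, of "\<lambda>u. Q u y"] by (simp add: dist)
  show "(\<integral>s. Q (\<xi> i k s) y \<partial>M) = y"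
    using int(2) integral_distr[OF \<xi>, of "\<lambda>u. Q u y"] by (simp add: dist)
  have "(\<integral>\<^sup>+s. ennreal ((norm (Q (\<xi> i k s) y - y))\<^sup>2) \<partial>M) = (\<integral>\<^sup>+u. ennreal ((norm (Q u y - y))\<^sup>2) \<partial>U)"
    using nn_integral_distr[OF \<xi>, of "\<lambda>u. ennreal ((norm (Q u y - y))\<^sup>2)"] by (simp add: dist)
  also have "\<dots> \<le> ennreal (\<omega> * (norm y)\<^sup>2)"
    using int by (simp add: nn_integral_eq_integral ennreal_leI)
  finally show "(\<integral>\<^sup>+s. ennreal ((norm (Q (\<xi> i k s) y - y))\<^sup>2) \<partial>M) \<le> ennreal (\<omega> * (norm y)\<^sup>2)" .
  show "(\<integral>\<^sup>+s. ennreal (real (l0norm (Q (\<xi> i k s) y))) \<partial>M) \<le> ennreal (expected_density U Q)"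
    using nn_integral_distr[OF \<xi>, of "\<lambda>u. ennreal (real (l0norm (Q u y)))"]
      expected_l0norm_le_density[OF quant, of y] by (simp add: dist)
qed

text \<open>\<open>I\<close> may contain samples of the current iteration as long as the minibatch
  of worker \<open>i\<close> is missing, so workers can be added one after another. The factor
  \<open>r\<close> has two uses: 1/n for the share of one worker in the mean, and 1 for the second
  moment of the minibatch difference.\<close>

lemma nn_integral_add_minibatch_noise:
  assumes i: "i \<in> {1..n}" and I: "past k \<subseteq> I" "I \<subseteq> samples" "Batch i k \<notin> I"
    and a: "a \<in> borel_measurable (alg I)"
  shows "(\<integral>\<^sup>+s. ennreal ((norm (a s + r *\<^sub>R (mdiff i k s s - gdiff i k s)))\<^sup>2) \<partial>M)
    \<le> (\<integral>\<^sup>+s. ennreal ((norm (a s))\<^sup>2) \<partial>M)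
      + ennreal (r\<^sup>2 * ((\<L>w i)\<^sup>2 / real b)) * (\<integral>\<^sup>+s. ennreal (sqstep k s) \<partial>M)"
proof -
  let ?D = "\<lambda>s s'. r *\<^sub>R (mdiff i k s s' - gdiff i k s)"
  let ?v = "\<lambda>s. r\<^sup>2 * ((\<L>w i)\<^sup>2 / real b) * sqstep k s"
  have "(\<integral>\<^sup>+s. ennreal ((norm (a s + ?D s s))\<^sup>2) \<partial>M)
      \<le> (\<integral>\<^sup>+s. ennreal ((norm (a s))\<^sup>2) \<partial>M) + (\<integral>\<^sup>+s. ennreal (?v s) \<partial>M)"
  proof (rule nn_integral_add_noise[where A = "alg I" and B = "alg {Batch i k}" and D = ?D and v = ?v])
    show "subalgebra M (alg I)" "subalgebra M (alg {Batch i k})"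
      by (intro subalgebra_alg I sample_sets i)+
    show "indep_set (sets (alg I)) (sets (alg {Batch i k}))"
      by (intro indep_alg I sample_sets i) (use I in auto)
    have [measurable]: "(\<lambda>z. mdiff i k (fst z) (snd z)) \<in> borel_measurable (alg I \<Otimes>\<^sub>M alg {Batch i k})"
      using mdiff_measurable[OF i I(1), of "{Batch i k}"] by (simp add: split_beta')
    have [measurable]: "gdiff i k \<in> borel_measurable (alg I)"
      by (intro gdiff_measurable i I)
    show "(\<lambda>(s, s'). ?D s s') \<in> borel_measurable (alg I \<Otimes>\<^sub>M alg {Batch i k})"
      unfolding split_beta' by measurable
    show "AE s in M. integrable M (?D s) \<and> expectation (?D s) = 0"
      using minibatch_noise[OF i, of k] AE_space
    proof eventually_elim
      case (elim s)
      then show ?case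
        using integrable_mdiff[OF i, of s k] by (simp add: prob_space)
    qed
    show "AE s in M. (\<integral>\<^sup>+s'. ennreal ((norm (?D s s'))\<^sup>2) \<partial>M) \<le> ennreal (?v s)"
      using minibatch_noise[OF i, of k] AE_space
    proof eventually_elim
      case (elim s)
      then have [measurable]: "random_variable borel (mdiff i k s)"
        using integrable_mdiff[OF i, of s k] by auto
      have "(\<integral>\<^sup>+s'. ennreal ((norm (?D s s'))\<^sup>2) \<partial>M)
          = ennreal (r\<^sup>2) * (\<integral>\<^sup>+s'. ennreal ((norm (mdiff i k s s' - gdiff i k s))\<^sup>2) \<partial>M)"
        by (subst nn_integral_cmult_real[symmetric]) (auto simp: power_mult_distrib)
      also have "\<dots> \<le> ennreal (r\<^sup>2) * ennreal ((\<L>w i)\<^sup>2 / real b * sqstep k s)"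
        using elim by (intro mult_left_mono) auto
      also have "\<dots> = ennreal (?v s)"
        by (simp add: ennreal_mult'[symmetric] mult.assoc)
      finally show ?case .
    qed
  qed (auto intro: a)
  also have "(\<integral>\<^sup>+s. ennreal (?v s) \<partial>M)
      = ennreal (r\<^sup>2 * ((\<L>w i)\<^sup>2 / real b)) * (\<integral>\<^sup>+s. ennreal (sqstep k s) \<partial>M)"
    by (intro nn_integral_cmult_real) auto
  finally show ?thesis .
qed

text \<open>Per unit of squared step: the minibatch variance \<open>(\<L>w i)\<^sup>2 / b\<close>,
  plus \<omega> times the bound \<open>(Lw i)\<^sup>2 + (\<L>w i)\<^sup>2 / b\<close> on the second
  moment of the vector being quantized.\<close>

definition worker_var :: "nat \<Rightarrow> real" where
  "worker_var i = \<omega> * (Lw i)\<^sup>2 + (1 + \<omega>) * (\<L>w i)\<^sup>2 / real b"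

lemma \<omega>_pos: "0 < \<omega>"
  using quant by (simp add: quantization_def)

text \<open>Two layers of noise are removed, the later one first. Given \<open>?J\<close>, which
  includes the minibatch but not the seed, the quantized vector is centered at the minibatch
  difference; given \<open>I\<close>, the minibatch difference is centered at the full one.\<close>

lemma nn_integral_add_worker_noise:
  assumes i: "i \<in> {1..n}" and I: "past k \<subseteq> I" "I \<subseteq> samples" "Batch i k \<notin> I" "Seed i k \<notin> I"
    and a: "a \<in> borel_measurable (alg I)"
  shows "(\<integral>\<^sup>+s. ennreal ((norm (a s + r *\<^sub>R (Q (\<xi> i k s) (mdiff i k s s) - gdiff i k s)))\<^sup>2) \<partial>M)
    \<le> (\<integral>\<^sup>+s. ennreal ((norm (a s))\<^sup>2) \<partial>M)
      + ennreal (r\<^sup>2 * worker_var i) * (\<integral>\<^sup>+s. ennreal (sqstep k s) \<partial>M)"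
proof -
  let ?R = "\<integral>\<^sup>+s. ennreal (sqstep k s) \<partial>M"
  let ?J = "insert (Batch i k) I"
  let ?md = "\<lambda>s. mdiff i k s s"
  let ?a' = "\<lambda>s. a s + r *\<^sub>R (?md s - gdiff i k s)"
  let ?D = "\<lambda>s s'. r *\<^sub>R (Q (\<xi> i k s') (?md s) - ?md s)"
  let ?v = "\<lambda>s. (r\<^sup>2 * \<omega>) * (norm (?md s))\<^sup>2"
  have J: "past k \<subseteq> ?J" "?J \<subseteq> samples"
    using I sample_sets(1)[OF i] by auto
  have md [measurable]: "?md \<in> borel_measurable (alg ?J)"
    by (intro mdiff_diagonal_measurable i J) simp
  have [measurable]: "?md \<in> borel_measurable M"
    using measurable_from_subalg[OF subalgebra_alg[OF J(2)] md] .
  have gd [measurable]: "gdiff i k \<in> borel_measurable (alg ?J)"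
    by (intro gdiff_measurable i J)
  have [measurable]: "gdiff i k \<in> borel_measurable M"
    using measurable_from_subalg[OF subalgebra_alg[OF J(2)] gd] .
  have [measurable]: "a \<in> borel_measurable (alg ?J)"
    using a by (rule measurable_alg_mono) auto
  have eq: "a s + r *\<^sub>R (Q (\<xi> i k s) (?md s) - gdiff i k s) = ?a' s + ?D s s" for s
    by (simp add: algebra_simps)
  have "(\<integral>\<^sup>+s. ennreal ((norm (?a' s + ?D s s))\<^sup>2) \<partial>M)
      \<le> (\<integral>\<^sup>+s. ennreal ((norm (?a' s))\<^sup>2) \<partial>M) + (\<integral>\<^sup>+s. ennreal (?v s) \<partial>M)"
  proof (rule nn_integral_add_noise[where A = "alg ?J" and B = "alg {Seed i k}" and a = ?a' and D = ?D and v = ?v])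
    show "subalgebra M (alg ?J)" "subalgebra M (alg {Seed i k})"
      by (intro subalgebra_alg J sample_sets i)+
    show "indep_set (sets (alg ?J)) (sets (alg {Seed i k}))"
      by (intro indep_alg J sample_sets i) (use I in auto)
    have [measurable]: "(\<lambda>z. Q (\<xi> i k (snd z)) (?md (fst z))) \<in> borel_measurable (alg ?J \<Otimes>\<^sub>M alg {Seed i k})"
      by (intro Q_measurable measurable_compose[OF measurable_snd] measurable_compose[OF measurable_fst]
          seed_measurable i md) auto
    show "(\<lambda>(s, s'). ?D s s') \<in> borel_measurable (alg ?J \<Otimes>\<^sub>M alg {Seed i k})"
      unfolding split_beta' by measurable
    show "?a' \<in> borel_measurable (alg ?J)" by measurable
    show "AE s in M. integrable M (?D s) \<and> expectation (?D s) = 0"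
      using quantization_noise(1,2)[OF i] by (intro AE_I2) (simp add: prob_space)
    show "AE s in M. (\<integral>\<^sup>+s'. ennreal ((norm (?D s s'))\<^sup>2) \<partial>M) \<le> ennreal (?v s)"
    proof (rule AE_I2)
      fix s
      have [measurable]: "random_variable borel (\<lambda>s'. Q (\<xi> i k s') (?md s))"
        using quantization_noise(1)[OF i] by auto
      have "(\<integral>\<^sup>+s'. ennreal ((norm (?D s s'))\<^sup>2) \<partial>M)
          = ennreal (r\<^sup>2) * (\<integral>\<^sup>+s'. ennreal ((norm (Q (\<xi> i k s') (?md s) - ?md s))\<^sup>2) \<partial>M)"
        by (subst nn_integral_cmult_real[symmetric]) (auto simp: power_mult_distrib)
      also have "\<dots> \<le> ennreal (r\<^sup>2) * ennreal (\<omega> * (norm (?md s))\<^sup>2)"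
        by (intro mult_left_mono quantization_noise i) auto
      also have "\<dots> = ennreal (?v s)"
        by (simp add: ennreal_mult'[symmetric] mult.assoc)
      finally show "(\<integral>\<^sup>+s'. ennreal ((norm (?D s s'))\<^sup>2) \<partial>M) \<le> ennreal (?v s)" .
    qed
  qed measurable
  also have "(\<integral>\<^sup>+s. ennreal ((norm (?a' s))\<^sup>2) \<partial>M)
      \<le> (\<integral>\<^sup>+s. ennreal ((norm (a s))\<^sup>2) \<partial>M) + ennreal (r\<^sup>2 * ((\<L>w i)\<^sup>2 / real b)) * ?R"
    by (rule nn_integral_add_minibatch_noise[OF i I(1,2,3) a])
  also have "(\<integral>\<^sup>+s. ennreal (?v s) \<partial>M) \<le> ennreal (r\<^sup>2 * (\<omega> * ((Lw i)\<^sup>2 + (\<L>w i)\<^sup>2 / real b))) * ?R"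
  proof -
    \<comment> \<open>With \<open>a\<close> the full difference and \<open>r\<close> = 1, the sum in
      the minibatch lemma collapses to the minibatch difference itself.\<close>
    have "(\<integral>\<^sup>+s. ennreal ((norm (?md s))\<^sup>2) \<partial>M)
        \<le> (\<integral>\<^sup>+s. ennreal ((norm (gdiff i k s))\<^sup>2) \<partial>M) + ennreal ((\<L>w i)\<^sup>2 / real b) * ?R"
      using nn_integral_add_minibatch_noise[OF i I(1,2,3) gdiff_measurable[OF i I(1)], of 1] by simp
    also have "(\<integral>\<^sup>+s. ennreal ((norm (gdiff i k s))\<^sup>2) \<partial>M) \<le> (\<integral>\<^sup>+s. ennreal ((Lw i)\<^sup>2 * sqstep k s) \<partial>M)"
      unfolding gdiff_def sqstep_def
      by (intro nn_integral_mono ennreal_leI norm_grad_local_power2_le i)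
    also have "\<dots> = ennreal ((Lw i)\<^sup>2) * ?R"
      by (intro nn_integral_cmult_real) auto
    finally have "(\<integral>\<^sup>+s. ennreal ((norm (?md s))\<^sup>2) \<partial>M) \<le> ennreal ((Lw i)\<^sup>2 + (\<L>w i)\<^sup>2 / real b) * ?R"
      by (simp add: ennreal_plus distrib_right)
    then have "ennreal (r\<^sup>2 * \<omega>) * (\<integral>\<^sup>+s. ennreal ((norm (?md s))\<^sup>2) \<partial>M)
        \<le> ennreal (r\<^sup>2 * \<omega>) * (ennreal ((Lw i)\<^sup>2 + (\<L>w i)\<^sup>2 / real b) * ?R)"
      by (rule mult_left_mono) simp
    moreover have "(\<integral>\<^sup>+s. ennreal (?v s) \<partial>M) = ennreal (r\<^sup>2 * \<omega>) * (\<integral>\<^sup>+s. ennreal ((norm (?md s))\<^sup>2) \<partial>M)"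
      using \<omega>_pos by (intro nn_integral_cmult_real) auto
    ultimately show ?thesis
      using \<omega>_pos by (simp add: ennreal_mult mult.assoc)
  qed
  finally have "(\<integral>\<^sup>+s. ennreal ((norm (?a' s + ?D s s))\<^sup>2) \<partial>M)
      \<le> (\<integral>\<^sup>+s. ennreal ((norm (a s))\<^sup>2) \<partial>M)
        + (ennreal (r\<^sup>2 * ((\<L>w i)\<^sup>2 / real b)) + ennreal (r\<^sup>2 * (\<omega> * ((Lw i)\<^sup>2 + (\<L>w i)\<^sup>2 / real b)))) * ?R"
    by (simp add: distrib_right add.assoc add_mono)
  also have "ennreal (r\<^sup>2 * ((\<L>w i)\<^sup>2 / real b)) + ennreal (r\<^sup>2 * (\<omega> * ((Lw i)\<^sup>2 + (\<L>w i)\<^sup>2 / real b)))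
      = ennreal (r\<^sup>2 * worker_var i)"
    using \<omega>_pos dims by (subst ennreal_plus[symmetric]) (auto simp: worker_var_def field_simps)
  finally show ?thesis by (simp only: eq)
qed

section \<open>Error of the gradient estimator\<close>

definition err :: "nat \<Rightarrow> 's \<Rightarrow> real ^ 'd" where
  "err k s = g k s - grad F (x k s)"

text \<open>Interpolates between the old error (j = 0) and the error after an iteration without full
  gradient (j = n), one worker at a time.\<close>

definition partial_err :: "nat \<Rightarrow> nat \<Rightarrow> 's \<Rightarrow> real ^ 'd" where
  "partial_err k j s = err k s + (\<Sum>i=1..j. (1 / real n) *\<^sub>R (Q (\<xi> i k s) (mdiff i k s s) - gdiff i k s))"

definition upto_worker :: "nat \<Rightarrow> nat \<Rightarrow> sample set" where
  "upto_worker k j = past k \<union> {Batch i k | i. i \<in> {1..j}} \<union> {Seed i k | i. i \<in> {1..j}}"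

lemma upto_worker: "past k \<subseteq> upto_worker k j" "j \<le> n \<Longrightarrow> upto_worker k j \<subseteq> samples"
  "Batch (Suc j) k \<notin> upto_worker k j" "Seed (Suc j) k \<notin> upto_worker k j" "Coin k \<notin> upto_worker k j"
  by (auto simp: upto_worker_def past_def samples_def)

lemma err_measurable: "past k \<subseteq> I \<Longrightarrow> err k \<in> borel_measurable (alg I)"
  unfolding err_def[abs_def]
  by (intro borel_measurable_diff measurable_compose[OF _ borel_measurable_grad_F] iterate_measurable)

lemma err_random_variable [measurable]: "random_variable borel (err k)"
  unfolding err_def[abs_def] by measurable

lemma partial_err_measurable:
  assumes "j \<le> n"
  shows "partial_err k j \<in> borel_measurable (alg (upto_worker k j))"
proof -
  let ?A = "alg (upto_worker k j)"
  have "(\<lambda>s. Q (\<xi> i k s) (mdiff i k s s) - gdiff i k s) \<in> borel_measurable ?A" if "i \<in> {1..j}" for i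
  proof -
    have "i \<in> {1..n}" "Seed i k \<in> upto_worker k j" "Batch i k \<in> upto_worker k j"
      using that assms by (auto simp: upto_worker_def)
    then show ?thesis
      by (intro borel_measurable_diff Q_measurable seed_measurable mdiff_diagonal_measurable
          gdiff_measurable upto_worker)
  qed
  then show ?thesis
    unfolding partial_err_def[abs_def]
    by (intro borel_measurable_add borel_measurable_sum borel_measurable_scaleR borel_measurable_const
        err_measurable upto_worker)
qed

text \<open>Each worker's noise is centered given all previous ones, so no cross terms between
  workers appear and the variances add up. The squared factors 1/n are the source of the division by
  n in the stepsize condition.\<close>

lemma partial_err_bound:
  "j \<le> n \<Longrightarrow> (\<integral>\<^sup>+s. ennreal ((norm (partial_err k j s))\<^sup>2) \<partial>M)
    \<le> (\<integral>\<^sup>+s. ennreal ((norm (err k s))\<^sup>2) \<partial>M)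
      + ennreal (\<Sum>i=1..j. (1 / real n)\<^sup>2 * worker_var i) * (\<integral>\<^sup>+s. ennreal (sqstep k s) \<partial>M)"
proof (induction j)
  case 0
  then show ?case by (simp add: partial_err_def)
next
  case (Suc j)
  let ?R = "\<integral>\<^sup>+s. ennreal (sqstep k s) \<partial>M"
  have nonneg: "0 \<le> worker_var i" for i
    using \<omega>_pos by (simp add: worker_var_def)
  have "(\<integral>\<^sup>+s. ennreal ((norm (partial_err k (Suc j) s))\<^sup>2) \<partial>M)
      = (\<integral>\<^sup>+s. ennreal ((norm (partial_err k j s + (1 / real n) *\<^sub>R
          (Q (\<xi> (Suc j) k s) (mdiff (Suc j) k s s) - gdiff (Suc j) k s)))\<^sup>2) \<partial>M)"
    by (simp add: partial_err_def add.assoc)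
  also have "\<dots> \<le> (\<integral>\<^sup>+s. ennreal ((norm (partial_err k j s))\<^sup>2) \<partial>M)
      + ennreal ((1 / real n)\<^sup>2 * worker_var (Suc j)) * ?R"
    using Suc.prems
    by (intro nn_integral_add_worker_noise[where I = "upto_worker k j"] upto_worker partial_err_measurable) auto
  also have "\<dots> \<le> ((\<integral>\<^sup>+s. ennreal ((norm (err k s))\<^sup>2) \<partial>M)
      + ennreal (\<Sum>i=1..j. (1 / real n)\<^sup>2 * worker_var i) * ?R)
      + ennreal ((1 / real n)\<^sup>2 * worker_var (Suc j)) * ?R"
    using Suc by (intro add_right_mono) simp
  also have "\<dots> = (\<integral>\<^sup>+s. ennreal ((norm (err k s))\<^sup>2) \<partial>M)
      + ennreal (\<Sum>i=1..Suc j. (1 / real n)\<^sup>2 * worker_var i) * ?R"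
    using nonneg by (simp add: ennreal_plus sum_nonneg distrib_right add.assoc)
  finally show ?case .
qed

text \<open>A full gradient resets the error. Otherwise subtracting the mean of the full differences
  moves the reference point of the error from x^k to x^{k+1}.\<close>

lemma err_Suc:
  assumes "s \<in> space M"
  shows "err (Suc k) s = (if c k s then 0 else partial_err k n s)"
proof -
  have "(\<Sum>i=1..n. (1 / real n) *\<^sub>R (Q (\<xi> i k s) (mdiff i k s s) - gdiff i k s))
      = (1 / real n) *\<^sub>R (\<Sum>i=1..n. Q (\<xi> i k s) (mdiff i k s s)) - (grad F (x (Suc k) s) - grad F (x k s))"
    by (simp add: gdiff_def grad_F sum_subtractf scaleR_diff_right scaleR_sum_right)
  then show ?thesis
    using g_Suc[OF assms, of k] by (simp add: err_def partial_err_def mdiff_def)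
qed

lemma nn_integral_coin:
  "(\<integral>\<^sup>+s. h (c k s) \<partial>M) = h True * ennreal p + h False * ennreal (1 - p)"
proof -
  have c: "c k \<in> M \<rightarrow>\<^sub>M count_space UNIV" "distr M (count_space UNIV) (c k) = measure_pmf (bernoulli_pmf p)"
    using sampling unfolding vr_marina_sampling_def by blast+
  have "(\<integral>\<^sup>+s. h (c k s) \<partial>M) = (\<integral>\<^sup>+z. h z \<partial>measure_pmf (bernoulli_pmf p))"
    unfolding c(2)[symmetric] using c(1) by (simp add: nn_integral_distr)
  then show ?thesis
    using p01 by simp
qed

text \<open>The mean of \<open>worker_var\<close> over the workers.\<close>

definition noise_const :: real where
  "noise_const = \<omega> * L\<^sup>2 + (1 + \<omega>) * \<L>\<^sup>2 / real b"

text \<open>\<open>upto_worker k n\<close> leaves out the coin of iteration k, which is thus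
  independent of \<open>partial_err k n\<close>. Integrating the coin out first, the reset to 0
  contributes exactly the factor 1 - p.\<close>

lemma err_recursion:
  "(\<integral>\<^sup>+s. ennreal ((norm (err (Suc k) s))\<^sup>2) \<partial>M)
    \<le> ennreal (1 - p) * ((\<integral>\<^sup>+s. ennreal ((norm (err k s))\<^sup>2) \<partial>M)
        + ennreal (noise_const / real n) * (\<integral>\<^sup>+s. ennreal (sqstep k s) \<partial>M))"
proof -
  let ?A = "alg (upto_worker k n)" and ?B = "alg {Coin k}"
  let ?\<Psi> = "\<lambda>z. if c k (snd z) then 0 else ennreal ((norm (partial_err k n (fst z)))\<^sup>2)"
  have [measurable]: "c k \<in> ?B \<rightarrow>\<^sub>M count_space UNIV" "partial_err k n \<in> borel_measurable ?A"
    by (auto intro: coin_measurable partial_err_measurable)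
  have A: "subalgebra M ?A" by (intro subalgebra_alg upto_worker) simp
  have [measurable]: "partial_err k n \<in> borel_measurable M"
    using measurable_from_subalg[OF A partial_err_measurable[OF order_refl]] .
  have "(\<integral>\<^sup>+s. ennreal ((norm (err (Suc k) s))\<^sup>2) \<partial>M) = (\<integral>\<^sup>+s. ?\<Psi> (s, s) \<partial>M)"
    by (intro nn_integral_cong) (simp add: err_Suc)
  also have "\<dots> = (\<integral>\<^sup>+s. \<integral>\<^sup>+s'. ?\<Psi> (s, s') \<partial>M \<partial>M)"
  proof (rule nn_integral_indep_diagonal[OF A])
    show "subalgebra M ?B" by (intro subalgebra_alg sample_sets)
    show "indep_set (sets ?A) (sets ?B)"
      by (intro indep_alg upto_worker sample_sets) (use upto_worker in auto)
    show "?\<Psi> \<in> borel_measurable (?A \<Otimes>\<^sub>M ?B)" by measurable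
  qed
  also have "\<dots> = (\<integral>\<^sup>+s. ennreal (1 - p) * ennreal ((norm (partial_err k n s))\<^sup>2) \<partial>M)"
    using nn_integral_coin[where h = "\<lambda>z. if z then 0 else ennreal ((norm (partial_err k n t))\<^sup>2)" for t]
    by (simp only: fst_conv snd_conv) (simp add: mult.commute)
  also have "\<dots> = ennreal (1 - p) * (\<integral>\<^sup>+s. ennreal ((norm (partial_err k n s))\<^sup>2) \<partial>M)"
    by (simp add: nn_integral_cmult)
  also have "\<dots> \<le> ennreal (1 - p) * ((\<integral>\<^sup>+s. ennreal ((norm (err k s))\<^sup>2) \<partial>M)
      + ennreal (\<Sum>i=1..n. (1 / real n)\<^sup>2 * worker_var i) * (\<integral>\<^sup>+s. ennreal (sqstep k s) \<partial>M))"
    by (intro mult_left_mono partial_err_bound) auto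
  also have "(\<Sum>i=1..n. (1 / real n)\<^sup>2 * worker_var i) = noise_const / real n"
  proof -
    have L2: "L\<^sup>2 = (\<Sum>i=1..n. (Lw i)\<^sup>2) / real n" "\<L>\<^sup>2 = (\<Sum>i=1..n. (\<L>w i)\<^sup>2) / real n"
      by (simp_all add: L_def \<L>_def sum_nonneg)
    have "(\<Sum>i=1..n. worker_var i)
        = \<omega> * (\<Sum>i=1..n. (Lw i)\<^sup>2) + (1 + \<omega>) * (\<Sum>i=1..n. (\<L>w i)\<^sup>2) / real b"
      by (simp add: worker_var_def sum.distrib sum_distrib_left sum_divide_distrib)
    also have "\<dots> = real n * noise_const"
      using dims unfolding noise_const_def L2 by (simp add: field_simps)
    finally show ?thesis
      using dims by (simp only: sum_distrib_left[symmetric]) (simp add: power2_eq_square)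
  qed
  finally show ?thesis .
qed

subsection \<open>Contraction of the potential\<close>

text \<open>Polarization splits the inner product of the gradient and \<open>g k s\<close> into the
  squares of the error, of \<open>g k s\<close> and of the gradient. The gradient square is spent on
  the PL inequality; the square of \<open>g k s\<close> is a multiple of \<open>sqstep\<close> and
  stays on the left.\<close>

lemma descent_step:
  assumes "\<gamma> > 0" "s \<in> space M"
    and PL: "2 * \<mu> * (F (x k s) - Fstar) \<le> (norm (grad F (x k s)))\<^sup>2"
  shows "F (x (Suc k) s) - Fstar + (1 / (2 * \<gamma>) - L / 2) * sqstep k s
    \<le> (1 - \<gamma> * \<mu>) * (F (x k s) - Fstar) + \<gamma> / 2 * (norm (err k s))\<^sup>2"
proof -
  let ?G = "grad F (x k s)"
  have step: "x (Suc k) s - x k s = - \<gamma> *\<^sub>R g k s"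
    using x_Suc assms by simp
  have sq: "sqstep k s = \<gamma>\<^sup>2 * (norm (g k s))\<^sup>2"
    by (simp add: sqstep_def step power_mult_distrib)
  have err: "(norm (err k s))\<^sup>2 = (norm (g k s))\<^sup>2 - 2 * (?G \<bullet> g k s) + (norm ?G)\<^sup>2"
    by (simp add: err_def power2_norm_eq_inner inner_diff inner_commute)
  have "F (x (Suc k) s) \<le> F (x k s) + ?G \<bullet> (x (Suc k) s - x k s) + L / 2 * sqstep k s"
    unfolding sqstep_def by (rule smooth_descent[OF GDERIV_F F_smooth])
  moreover have "?G \<bullet> (x (Suc k) s - x k s) = - \<gamma> * (?G \<bullet> g k s)"
    by (simp add: step)
  moreover have "1 / (2 * \<gamma>) * sqstep k s = \<gamma> / 2 * (norm (g k s))\<^sup>2"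
    using assms by (simp add: sq power2_eq_square)
  moreover have "\<gamma> / 2 * (2 * \<mu> * (F (x k s) - Fstar)) \<le> \<gamma> / 2 * (norm ?G)\<^sup>2"
    using assms by (intro mult_left_mono) auto
  ultimately show ?thesis
    by (simp add: err algebra_simps)
qed

definition potential :: "real \<Rightarrow> nat \<Rightarrow> ennreal" where
  "potential Fstar k = (\<integral>\<^sup>+s. ennreal (F (x k s) - Fstar) \<partial>M)
    + ennreal (\<gamma> / p) * (\<integral>\<^sup>+s. ennreal ((norm (err k s))\<^sup>2) \<partial>M)"

lemma potential_contraction:
  assumes \<gamma>: "\<gamma> > 0" "\<gamma> * L \<le> 1" "\<gamma> * \<mu> \<le> p / 2" "\<mu> > 0"
    and noise: "\<gamma> / p * (1 - p) * (noise_const / real n) \<le> 1 / (2 * \<gamma>) - L / 2"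
    and lower: "\<And>y. Fstar \<le> F y"
    and PL: "\<And>y. 2 * \<mu> * (F y - Fstar) \<le> (norm (grad F y))\<^sup>2"
  shows "potential Fstar (Suc k) \<le> ennreal (1 - \<gamma> * \<mu>) * potential Fstar k"
proof -
  define \<rho> where "\<rho> = 1 / (2 * \<gamma>) - L / 2"
  define q where "q = 1 - \<gamma> * \<mu>"
  let ?a = "\<lambda>k. \<integral>\<^sup>+s. ennreal (F (x k s) - Fstar) \<partial>M"
  let ?e = "\<lambda>k. \<integral>\<^sup>+s. ennreal ((norm (err k s))\<^sup>2) \<partial>M"
  let ?R = "\<integral>\<^sup>+s. ennreal (sqstep k s) \<partial>M"
  have \<rho>: "0 \<le> \<rho>" using \<gamma> by (simp add: \<rho>_def field_simps)
  have q: "0 \<le> q" using \<gamma> p01 by (simp add: q_def)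
  have nc: "0 \<le> noise_const" using \<omega>_pos by (simp add: noise_const_def)
  \<comment> \<open>The step term with coefficient \<open>\<rho>\<close> is kept on the left as a
    reserve against the noise, since possibly infinite quantities must not be subtracted. The
    premise \<open>noise\<close> says that the reserve suffices.\<close>
  have "?a (Suc k) + ennreal \<rho> * ?R = (\<integral>\<^sup>+s. ennreal (F (x (Suc k) s) - Fstar + \<rho> * sqstep k s) \<partial>M)"
    using \<rho> lower by (simp add: nn_integral_cmult_real[symmetric] nn_integral_add[symmetric]
        ennreal_plus sqstep_def)
  also have "\<dots> \<le> (\<integral>\<^sup>+s. ennreal (q * (F (x k s) - Fstar) + \<gamma> / 2 * (norm (err k s))\<^sup>2) \<partial>M)"
    using descent_step[OF \<gamma>(1) _ PL] by (intro nn_integral_mono ennreal_leI) (simp add: \<rho>_def q_def)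
  also have "\<dots> = ennreal q * ?a k + ennreal (\<gamma> / 2) * ?e k"
    using q \<gamma> lower by (simp add: nn_integral_cmult_real[symmetric] nn_integral_add[symmetric] ennreal_plus)
  finally have a: "?a (Suc k) + ennreal \<rho> * ?R \<le> ennreal q * ?a k + ennreal (\<gamma> / 2) * ?e k" .
  have "ennreal (\<gamma> / p) * ?e (Suc k)
      \<le> ennreal (\<gamma> / p) * (ennreal (1 - p) * (?e k + ennreal (noise_const / real n) * ?R))"
    by (intro mult_left_mono err_recursion) simp
  also have "\<dots> = ennreal (\<gamma> / p * (1 - p)) * ?e k + ennreal (\<gamma> / p * (1 - p) * (noise_const / real n)) * ?R"
    using \<gamma> p01 nc by (simp add: ennreal_mult distrib_left mult.assoc
        del: times_divide_eq_left times_divide_eq_right)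
  also have "\<dots> \<le> ennreal (\<gamma> / p * (1 - p)) * ?e k + ennreal \<rho> * ?R"
    using noise by (intro add_left_mono mult_right_mono ennreal_leI) (auto simp: \<rho>_def)
  finally have "potential Fstar (Suc k)
      \<le> (?a (Suc k) + ennreal \<rho> * ?R) + ennreal (\<gamma> / p * (1 - p)) * ?e k"
    unfolding potential_def by (simp add: add_left_mono add.assoc add.commute add.left_commute)
  also have "\<dots> \<le> (ennreal q * ?a k + ennreal (\<gamma> / 2) * ?e k) + ennreal (\<gamma> / p * (1 - p)) * ?e k"
    using a by (rule add_right_mono)
  also have "\<dots> = ennreal q * ?a k + ennreal (\<gamma> / 2 + \<gamma> / p * (1 - p)) * ?e k"
    using \<gamma> p01 by (simp add: ennreal_plus distrib_right add.assoc)
  also have "\<dots> \<le> ennreal q * ?a k + ennreal (q * (\<gamma> / p)) * ?e k"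
  proof (intro add_left_mono mult_right_mono ennreal_leI)
    have "\<gamma> / p * (\<gamma> * \<mu>) \<le> \<gamma> / p * (p / 2)"
      using \<gamma> p01 by (intro mult_left_mono) auto
    also have "\<dots> = \<gamma> / 2" using p01 by simp
    finally have "\<gamma> / p * (\<gamma> * \<mu>) \<le> \<gamma> / 2" .
    moreover have "\<gamma> / p * (1 - p) = \<gamma> / p - \<gamma>"
      using p01 by (simp add: field_simps)
    moreover have "q * (\<gamma> / p) = \<gamma> / p - \<gamma> / p * (\<gamma> * \<mu>)"
      by (simp add: q_def algebra_simps)
    ultimately show "\<gamma> / 2 + \<gamma> / p * (1 - p) \<le> q * (\<gamma> / p)"
      by linarith
  qed simp
  also have "\<dots> = ennreal q * potential Fstar k"
    using q \<gamma> p01 by (simp add: potential_def ennreal_mult distrib_left mult.assoc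
        del: times_divide_eq_left times_divide_eq_right)
  finally show ?thesis by (simp add: q_def)
qed

text \<open>The initial gradient is exact, so the potential starts at the initial gap. The recursion
  then keeps the potential finite, and integrability of the gap is a result of it.\<close>

lemma expected_gap:
  assumes \<gamma>: "\<gamma> > 0" "\<gamma> * L \<le> 1" "\<gamma> * \<mu> \<le> p / 2" "\<mu> > 0"
    and noise: "\<gamma> / p * (1 - p) * (noise_const / real n) \<le> 1 / (2 * \<gamma>) - L / 2"
    and lower: "\<And>y. Fstar \<le> F y"
    and PL: "\<And>y. 2 * \<mu> * (F y - Fstar) \<le> (norm (grad F y))\<^sup>2"
  shows "integrable M (\<lambda>s. F (x K s) - Fstar)"
    and "(\<integral>s. F (x K s) - Fstar \<partial>M) \<le> (1 - \<gamma> * \<mu>) ^ K * (F x0 - Fstar)"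
proof -
  have q: "0 \<le> 1 - \<gamma> * \<mu>" using \<gamma> p01 by simp
  have "potential Fstar K \<le> ennreal ((1 - \<gamma> * \<mu>) ^ K * (F x0 - Fstar))"
  proof (induction K)
    case 0
    have "(\<integral>\<^sup>+s. ennreal (F (x 0 s) - Fstar) \<partial>M) = (\<integral>\<^sup>+s. ennreal (F x0 - Fstar) \<partial>M)"
      "(\<integral>\<^sup>+s. ennreal ((norm (err 0 s))\<^sup>2) \<partial>M) = (\<integral>\<^sup>+s. 0 \<partial>M)"
      by (rule nn_integral_cong, simp add: err_def x_0 g_0)+
    then show ?case
      by (simp add: potential_def emeasure_space_1)
  next
    case (Suc K)
    have "potential Fstar (Suc K) \<le> ennreal (1 - \<gamma> * \<mu>) * potential Fstar K"
      using assms by (rule potential_contraction)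
    also have "\<dots> \<le> ennreal (1 - \<gamma> * \<mu>) * ennreal ((1 - \<gamma> * \<mu>) ^ K * (F x0 - Fstar))"
      using Suc by (rule mult_left_mono) simp
    also have "\<dots> = ennreal ((1 - \<gamma> * \<mu>) ^ Suc K * (F x0 - Fstar))"
      using q by (simp add: ennreal_mult'[symmetric] mult.assoc)
    finally show ?case .
  qed
  moreover have "(\<integral>\<^sup>+s. ennreal (F (x K s) - Fstar) \<partial>M) \<le> potential Fstar K"
    by (simp add: potential_def)
  ultimately have le: "(\<integral>\<^sup>+s. ennreal (F (x K s) - Fstar) \<partial>M) \<le> ennreal ((1 - \<gamma> * \<mu>) ^ K * (F x0 - Fstar))"
    by (rule order_trans[rotated])
  show "integrable M (\<lambda>s. F (x K s) - Fstar)"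
    using le lower by (intro integrableI_bounded) (auto simp: le_less_trans)
  show "(\<integral>s. F (x K s) - Fstar \<partial>M) \<le> (1 - \<gamma> * \<mu>) ^ K * (F x0 - Fstar)"
    using le q lower by (intro integral_real_bounded) auto
qed

subsection \<open>Expected costs\<close>

lemma coin_random_variable [measurable]: "random_variable (count_space UNIV) (c k)"
  using sampling unfolding vr_marina_sampling_def by blast

lemma expected_oracle_calls:
  "(\<integral>s. real (oracle_calls m b (\<lambda>k. c k s) K) \<partial>M) \<le> real m + real K * (real m * p + 2 * real b)"
proof (rule integral_real_bounded)
  have "(\<integral>\<^sup>+s. ennreal (real (oracle_calls m b (\<lambda>k. c k s) K)) \<partial>M)
      = ennreal (real m) + (\<Sum>k<K. \<integral>\<^sup>+s. ennreal (if c k s then real m else real (2 * b)) \<partial>M)"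
  proof -
    have "ennreal (real (oracle_calls m b (\<lambda>k. c k s) K))
        = ennreal (real m) + (\<Sum>k<K. ennreal (if c k s then real m else real (2 * b)))" for s
      unfolding oracle_calls_def
      by (subst sum_ennreal) (auto simp: ennreal_plus[symmetric] sum_nonneg simp del: ennreal_plus
          intro!: arg_cong[where f = ennreal] sum.cong)
    then show ?thesis
      by (simp add: nn_integral_add nn_integral_sum emeasure_space_1 del: sum_ennreal)
  qed
  also have "\<dots> \<le> ennreal (real m) + (\<Sum>k<K. ennreal (real m * p + 2 * real b))"
  proof (intro add_left_mono sum_mono)
    fix k
    have "(\<integral>\<^sup>+s. ennreal (if c k s then real m else real (2 * b)) \<partial>M)
        = ennreal (real m * p + 2 * real b * (1 - p))"
      using p01 nn_integral_coin[of "\<lambda>z. ennreal (if z then real m else real (2 * b))" k]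
      by (simp add: ennreal_mult[symmetric] ennreal_plus[symmetric] del: ennreal_plus)
    also have "\<dots> \<le> ennreal (real m * p + 2 * real b)"
      using p01 by (intro ennreal_leI) (simp add: algebra_simps)
    finally show "(\<integral>\<^sup>+s. ennreal (if c k s then real m else real (2 * b)) \<partial>M) \<le> \<dots>" .
  qed
  also have "\<dots> = ennreal (real m + real K * (real m * p + 2 * real b))"
    using p01 by (simp add: ennreal_of_nat_eq_real_of_nat ennreal_mult[symmetric] ennreal_plus[symmetric]
        del: ennreal_plus)
  finally show "(\<integral>\<^sup>+s. ennreal (real (oracle_calls m b (\<lambda>k. c k s) K)) \<partial>M)
      \<le> ennreal (real m + real K * (real m * p + 2 * real b))" .
qed (use p01 in simp)

text \<open>The density bounds the quantization of fixed vectors, but here the argument is random.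
  The seed is independent of it, so freezing the argument makes the bound applicable.\<close>

lemma expected_quantized_l0norm:
  assumes i: "i \<in> {1..n}"
  shows "random_variable borel (\<lambda>s. Q (\<xi> i k s) (mdiff i k s s))"
    and "(\<integral>\<^sup>+s. ennreal (real (l0norm (Q (\<xi> i k s) (mdiff i k s s)))) \<partial>M) \<le> ennreal (expected_density U Q)"
proof -
  let ?J = "insert (Batch i k) (past k)"
  have J: "?J \<subseteq> samples" "past k \<subseteq> ?J"
    using past_subset sample_sets(1)[OF i] by auto
  have md: "(\<lambda>s. mdiff i k s s) \<in> borel_measurable (alg ?J)"
    by (intro mdiff_diagonal_measurable i) auto
  have A: "subalgebra M (alg ?J)" and B: "subalgebra M (alg {Seed i k})"
    by (intro subalgebra_alg J sample_sets i)+
  have ind: "indep_set (sets (alg ?J)) (sets (alg {Seed i k}))"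
    by (intro indep_alg J sample_sets i) (auto simp: past_def)
  have Q: "(\<lambda>z. Q (\<xi> i k (snd z)) (mdiff i k (fst z) (fst z))) \<in> borel_measurable (alg ?J \<Otimes>\<^sub>M alg {Seed i k})"
    by (intro Q_measurable measurable_compose[OF measurable_snd] seed_measurable i
        measurable_compose[OF measurable_fst md]) auto
  have "random_variable U (\<xi> i k)"
    using sampling i unfolding vr_marina_sampling_def by blast
  then show "random_variable borel (\<lambda>s. Q (\<xi> i k s) (mdiff i k s s))"
    by (intro Q_measurable measurable_from_subalg[OF A md])
  have "(\<integral>\<^sup>+s. ennreal (real (l0norm (Q (\<xi> i k s) (mdiff i k s s)))) \<partial>M)
      = (\<integral>\<^sup>+s. \<integral>\<^sup>+s'. ennreal (real (l0norm (Q (\<xi> i k s') (mdiff i k s s)))) \<partial>M \<partial>M)"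
    using nn_integral_indep_diagonal[OF A B ind,
        of "\<lambda>z. ennreal (real (l0norm (Q (\<xi> i k (snd z)) (mdiff i k (fst z) (fst z)))))"]
      measurable_compose[OF Q borel_measurable_l0norm] by simp
  also have "\<dots> \<le> (\<integral>\<^sup>+s. ennreal (expected_density U Q) \<partial>M)"
    by (intro nn_integral_mono quantization_noise i)
  finally show "(\<integral>\<^sup>+s. ennreal (real (l0norm (Q (\<xi> i k s) (mdiff i k s s)))) \<partial>M) \<le> ennreal (expected_density U Q)"
    by (simp add: emeasure_space_1)
qed

lemma expected_sent_components:
  assumes i: "i \<in> {1..n}"
  shows "(\<integral>s. real (sent_components m b f (\<lambda>k. c k s) (\<lambda>i k. S i k s) (\<lambda>i k. Q (\<xi> i k s)) (\<lambda>k. x k s) i K) \<partial>M)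
    \<le> real CARD('d) + real K * (real CARD('d) * p + expected_density U Q)" (is "(\<integral>s. real (?sent s) \<partial>M) \<le> _")
proof (rule integral_real_bounded)
  let ?d = "real CARD('d)" and ?\<zeta> = "expected_density U Q"
  let ?q = "\<lambda>k s. real (l0norm (Q (\<xi> i k s) (mdiff i k s s)))"
  have \<zeta>: "0 \<le> ?\<zeta>" using expected_density_pos[OF quant] by simp
  have [measurable]: "random_variable borel (?q k)" for k
    by (rule measurable_compose[OF expected_quantized_l0norm(1)[OF i] borel_measurable_l0norm])
  \<comment> \<open>Charging the quantized vector in every round, whatever the coin shows, puts coin
    and quantization into separate terms whose expectations can be taken one by one. Full gradients
    are charged as dense.\<close>
  have "real (?sent s) \<le> ?d + (\<Sum>k<K. (if c k s then ?d else 0) + ?q k s)" for s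
    unfolding sent_components_def of_nat_add of_nat_sum mdiff_def
    by (intro add_mono sum_mono) (auto simp: l0norm_le_CARD intro: add_increasing2)
  then have "(\<integral>\<^sup>+s. ennreal (real (?sent s)) \<partial>M)
      \<le> (\<integral>\<^sup>+s. ennreal (?d + (\<Sum>k<K. (if c k s then ?d else 0) + ?q k s)) \<partial>M)"
    by (intro nn_integral_mono ennreal_leI)
  also have "\<dots> = (\<integral>\<^sup>+s. ennreal ?d + (\<Sum>k<K. ennreal (if c k s then ?d else 0) + ennreal (?q k s)) \<partial>M)"
    by (intro nn_integral_cong) (simp add: sum_nonneg sum_ennreal[symmetric] ennreal_plus del: sum_ennreal)
  also have "\<dots> = ennreal ?d + (\<Sum>k<K. (\<integral>\<^sup>+s. ennreal (if c k s then ?d else 0) \<partial>M) + (\<integral>\<^sup>+s. ennreal (?q k s) \<partial>M))"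
    by (simp add: nn_integral_add nn_integral_sum emeasure_space_1)
  also have "\<dots> \<le> ennreal ?d + (\<Sum>k<K. ennreal (?d * p) + ennreal ?\<zeta>)"
  proof (intro add_left_mono sum_mono add_mono expected_quantized_l0norm(2) i)
    fix k
    show "(\<integral>\<^sup>+s. ennreal (if c k s then ?d else 0) \<partial>M) \<le> ennreal (?d * p)"
      using p01 nn_integral_coin[of "\<lambda>z. ennreal (if z then ?d else 0)" k]
      by (simp add: ennreal_mult)
  qed
  also have "\<dots> = ennreal (?d + real K * (?d * p + ?\<zeta>))"
    using p01 \<zeta> by (simp add: ennreal_of_nat_eq_real_of_nat ennreal_mult[symmetric] ennreal_plus[symmetric]
        del: ennreal_plus)
  finally show "(\<integral>\<^sup>+s. ennreal (real (?sent s)) \<partial>M) \<le> ennreal (?d + real K * (?d * p + ?\<zeta>))" .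
qed (use p01 expected_density_pos[OF quant] in simp)

end

section \<open>Complexity\<close>

lemma inverse_min:
  fixes u v :: real
  assumes "0 < u" "0 < v"
  shows "1 / min u v = max (1 / u) (1 / v)"
  using assms by (cases "u \<le> v") (auto simp: min_def max_def field_simps)

text \<open>Separates the two noise sources under the root in the stepsize; the factor sqrt 2 is
  rounded up to 2.\<close>

lemma sqrt_sum_le:
  fixes u v :: real
  assumes "0 \<le> u" "0 \<le> v"
  shows "sqrt (2 * (u\<^sup>2 + v\<^sup>2)) \<le> 2 * (u + v)"
  using assms by (intro real_le_lsqrt) (auto simp: power2_eq_square algebra_simps)

text \<open>Since \<gamma>L + \<gamma>s \<le> 1 with nonnegative summands, squaring \<gamma>s can
  only decrease it; division by 2\<gamma> gives the last claim.\<close>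

lemma stepsize_descent_condition:
  fixes L :: real
  assumes "0 < \<gamma>" "0 \<le> L" "0 \<le> s" "\<gamma> \<le> 1 / (L + s)"
  shows "0 < L + s" "\<gamma> * L \<le> 1" "\<gamma> * (s\<^sup>2 / 2) \<le> 1 / (2 * \<gamma>) - L / 2"
proof -
  \<comment> \<open>Division by zero yields 0, so L + s = 0 would force \<gamma> \<le> 0.\<close>
  show pos: "0 < L + s"
    using assms by (cases "L + s = 0") auto
  then have le: "\<gamma> * L + \<gamma> * s \<le> 1"
    using assms by (simp add: pos_le_divide_eq distrib_left)
  have nonneg: "0 \<le> \<gamma> * L" "0 \<le> \<gamma> * s" using assms by auto
  then show "\<gamma> * L \<le> 1" using le by linarith
  have "(\<gamma> * s)\<^sup>2 \<le> \<gamma> * s"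
    using le nonneg by (simp add: power2_eq_square mult_left_le)
  then have "\<gamma> * \<gamma> * s\<^sup>2 \<le> \<gamma> * s"
    by (simp add: power_mult_distrib power2_eq_square mult.commute mult.left_commute)
  with le have "\<gamma> * \<gamma> * s\<^sup>2 + \<gamma> * L \<le> 1" by linarith
  then show "\<gamma> * (s\<^sup>2 / 2) \<le> 1 / (2 * \<gamma>) - L / 2"
    using assms by (simp add: field_simps)
qed

text \<open>1/(\<gamma>\<mu>) is the number of rounds per unit of the logarithm. The factor 2 suits
  both entries of the minimum: s \<le> 2(u + v) gives L + s \<le> 2\<mu>B, and p/(2\<mu>) already
  carries a 2.\<close>

lemma inverse_stepsize_bound:
  fixes L \<L> \<omega> H n b :: real
  assumes "0 < \<mu>" "0 < p" "0 < \<theta>" "0 < \<gamma>" "0 \<le> L" "0 \<le> \<L>" "0 \<le> \<omega>" "0 \<le> H" "0 < n" "0 < b"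
    and s: "s = sqrt (2 * H / n * (\<omega> * L\<^sup>2 + (1 + \<omega>) * \<L>\<^sup>2 / b))" and pos: "0 < L + s"
    and \<gamma>: "\<theta> * min (1 / (L + s)) (p / (2 * \<mu>)) \<le> \<gamma>"
    and B: "B = max (1 / p) (L / \<mu> * (1 + sqrt (\<omega> * H / n)) + \<L> / \<mu> * sqrt ((1 + \<omega>) * H / (n * b)))"
  shows "0 < B" "1 / (\<gamma> * \<mu>) \<le> 2 * B / \<theta>"
proof -
  define u where "u = L * sqrt (\<omega> * H / n)"
  define v where "v = \<L> * sqrt ((1 + \<omega>) * H / (n * b))"
  have "2 * H / n * (\<omega> * L\<^sup>2 + (1 + \<omega>) * \<L>\<^sup>2 / b) = 2 * (u\<^sup>2 + v\<^sup>2)"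
    using assms by (simp add: u_def v_def power_mult_distrib) (simp add: field_simps)
  then have "s \<le> 2 * (u + v)"
    unfolding s using sqrt_sum_le[of u v] assms by (simp add: u_def v_def)
  moreover have "(L + (u + v)) / \<mu> \<le> B" "1 / p \<le> B"
    unfolding B u_def v_def by (auto simp: add_divide_distrib distrib_left)
  ultimately have le: "L + s \<le> 2 * \<mu> * B" "1 / p \<le> B"
    using assms by (auto simp: pos_divide_le_eq algebra_simps)
  show B_pos: "0 < B"
    using le(2) assms by (meson divide_pos_pos less_le_trans zero_less_one)
  have "1 / (2 * \<mu> * B) \<le> 1 / (L + s)"
    using le(1) pos by (intro frac_le) auto
  moreover have "1 \<le> B * p"
    using le(2) \<open>0 < p\<close> by (simp add: pos_divide_le_eq)
  then have "1 / (2 * \<mu> * B) \<le> p / (2 * \<mu>)"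
    using \<open>1 \<le> B * p\<close> \<open>0 < \<mu>\<close> B_pos by (simp add: field_simps)
  ultimately have "\<theta> * (1 / (2 * \<mu> * B)) \<le> \<theta> * min (1 / (L + s)) (p / (2 * \<mu>))"
    using assms by (intro mult_left_mono) auto
  with \<gamma> have "\<theta> / (2 * \<mu> * B) \<le> \<gamma>" by simp
  then show "1 / (\<gamma> * \<mu>) \<le> 2 * B / \<theta>"
    using \<open>0 < \<mu>\<close> \<open>0 < \<theta>\<close> \<open>0 < \<gamma>\<close> B_pos by (simp add: field_simps)
qed

text \<open>Rests on 1 - q \<le> exp(-q).\<close>

lemma geometric_decay_below:
  fixes q :: real
  assumes "0 < q" "q \<le> 1" "0 < \<epsilon>" "\<epsilon> \<le> \<Delta>" "ln (\<Delta> / \<epsilon>) / q \<le> real K"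
  shows "(1 - q) ^ K * \<Delta> \<le> \<epsilon>"
proof -
  have "(1 - q) ^ K \<le> exp (- q) ^ K"
    using assms exp_ge_add_one_self[of "- q"] by (intro power_mono) auto
  also have "\<dots> = exp (- (q * real K))"
    by (simp add: exp_of_nat_mult[symmetric] mult.commute)
  also have "\<dots> \<le> exp (- ln (\<Delta> / \<epsilon>))"
    using assms by (simp add: pos_divide_le_eq mult.commute)
  also have "\<dots> = \<epsilon> / \<Delta>"
    using assms by (simp add: exp_minus)
  finally show ?thesis
    using assms by (simp add: pos_le_divide_eq)
qed

text \<open>An upper bound on \<gamma> alone admits arbitrarily small steps and hence arbitrarily
  many rounds, so the complexity is stated for a stepsize within a factor \<theta> of the largest
  admissible one; 10/\<theta> is the constant behind the O-notation. A single \<open>K\<close>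
  serves all bounds. Integrability of the gap is claimed explicitly because the integral of a
  non-integrable function is 0 by convention.\<close>

theorem corollaryD2:
  fixes n m b :: nat
    and f :: "nat \<Rightarrow> nat \<Rightarrow> real ^ 'd \<Rightarrow> real"
    and F :: "real ^ 'd \<Rightarrow> real"
    and f_low \<mu> \<omega> \<zeta> d p \<gamma> \<theta> \<epsilon> \<Delta>\<^sub>0 L \<L> \<kappa> :: real
    and Lw \<L>w :: "nat \<Rightarrow> real"
    and x0 xstar :: "real ^ 'd"
    and M :: "'s measure" and U :: "'u measure"
    and Q :: "'u \<Rightarrow> real ^ 'd \<Rightarrow> real ^ 'd"
    and c :: "nat \<Rightarrow> 's \<Rightarrow> bool"
    and S :: "nat \<Rightarrow> nat \<Rightarrow> 's \<Rightarrow> nat set"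
    and \<xi> :: "nat \<Rightarrow> nat \<Rightarrow> 's \<Rightarrow> 'u"
    and x g :: "nat \<Rightarrow> 's \<Rightarrow> real ^ 'd"
    and cost :: "nat \<Rightarrow> nat \<Rightarrow> 's \<Rightarrow> real"
  assumes dims: "n \<ge> 1" "m \<ge> 1" "1 \<le> b" "b \<le> m" "d = real CARD('d)"
    and diff: "\<And>i j y. i \<in> {1..n} \<Longrightarrow> j \<in> {1..m} \<Longrightarrow> f i j differentiable (at y)"
    and F: "F = global_obj n m f"
    and lower: "\<And>y. F y \<ge> f_low"
    and smooth: "\<And>i y z. i \<in> {1..n} \<Longrightarrow>
        norm (grad (local_obj m f i) y - grad (local_obj m f i) z) \<le> Lw i * norm (y - z)"
    and argmin: "is_arg_min F (\<lambda>_. True) xstar"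
    and PL: "\<mu> > 0" "\<And>y. (norm (grad F y))\<^sup>2 \<ge> 2 * \<mu> * (F y - F xstar)"
    and L: "L = sqrt ((1 / real n) * (\<Sum>i=1..n. (Lw i)\<^sup>2))"
    and \<L>: "\<L> = sqrt ((1 / real n) * (\<Sum>i=1..n. (\<L>w i)\<^sup>2))"
    and \<Delta>\<^sub>0: "\<Delta>\<^sub>0 = F x0 - F xstar"
    and quant: "quantization U Q \<omega>"
    and \<zeta>: "\<zeta> = expected_density U Q"
    and p: "p = min (\<zeta> / d) (real b / (real m + real b))"
    and sampling: "vr_marina_sampling M U n m b p c S \<xi>"
    and run: "\<And>s. s \<in> space M \<Longrightarrow>
        vr_marina_run n m b f \<gamma> x0 (\<lambda>k. c k s) (\<lambda>i k. S i k s) (\<lambda>i k. Q (\<xi> i k s))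
          (\<lambda>k. x k s) (\<lambda>k. g k s)"
    and avg_smooth: "average_smooth M n m b f S x \<L>w"
    and stepsize: "\<gamma> > 0"
      "\<gamma> \<le> min (1 / (L + sqrt (2 * max (d / \<zeta> - 1) (real m / real b) / real n *
                                 (\<omega> * L\<^sup>2 + (1 + \<omega>) * \<L>\<^sup>2 / real b))))
                 (p / (2 * \<mu>))"
    and stepsize_order: "\<theta> > 0"
      "\<gamma> \<ge> \<theta> * min (1 / (L + sqrt (2 * max (d / \<zeta> - 1) (real m / real b) / real n *
                                 (\<omega> * L\<^sup>2 + (1 + \<omega>) * \<L>\<^sup>2 / real b))))
                 (p / (2 * \<mu>))"
    and cost: "\<kappa> > 0"
      "\<And>i K s. i \<in> {1..n} \<Longrightarrow> s \<in> space M \<Longrightarrow>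
        cost i K s = \<kappa> * real (sent_components m b f (\<lambda>k. c k s) (\<lambda>i k. S i k s)
                                 (\<lambda>i k. Q (\<xi> i k s)) (\<lambda>k. x k s) i K)"
    and eps: "0 < \<epsilon>" "\<epsilon> \<le> \<Delta>\<^sub>0"
  shows "\<exists>K::nat.
     integrable M (\<lambda>s. F (x K s) - F xstar) \<and>
     (\<integral>s. F (x K s) - F xstar \<partial>M) \<le> \<epsilon> \<and>
     int K \<le> \<lceil>(10 / \<theta>) *
       (max (1 / p)
            (L / \<mu> * (1 + sqrt (\<omega> * max (d / \<zeta> - 1) (real m / real b) / real n))
             + \<L> / \<mu> * sqrt ((1 + \<omega>) * max (d / \<zeta> - 1) (real m / real b) / (real n * real b)))
        * ln (\<Delta>\<^sub>0 / \<epsilon>))\<rceil> \<and>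
     (\<integral>s. real (oracle_calls m b (\<lambda>k. c k s) K) \<partial>M) \<le> (10 / \<theta>) *
       (real m +
        max (real b / p)
            (L / \<mu> * (real b + sqrt (\<omega> * max ((d / \<zeta> - 1) * (real b)\<^sup>2) (real m * real b) / real n))
             + \<L> / \<mu> * sqrt ((1 + \<omega>) * max ((d / \<zeta> - 1) * real b) (real m) / real n))
        * ln (\<Delta>\<^sub>0 / \<epsilon>)) \<and>
     (\<forall>i\<in>{1..n}. (\<integral>s. cost i K s \<partial>M) \<le> (10 / \<theta>) * \<kappa> *
       (d + \<zeta> *
        max (1 / p)
            (L / \<mu> * (1 + sqrt (\<omega> * max (d / \<zeta> - 1) (real m / real b) / real n))
             + \<L> / \<mu> * sqrt ((1 + \<omega>) * max (d / \<zeta> - 1) (real m / real b) / (real n * real b)))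
        * ln (\<Delta>\<^sub>0 / \<epsilon>)))"
proof -
  interpret M: prob_space M
    using sampling by (simp add: vr_marina_sampling_def)
  have \<zeta>: "0 < \<zeta>" "\<zeta> \<le> d"
    using expected_density_pos[OF quant] expected_density_le_CARD[OF quant] \<zeta> dims by simp_all
  have d: "0 < d" and nb: "0 < real n" "0 < real b" "0 < real m"
    using \<zeta> dims by auto
  define H where "H = max (d / \<zeta> - 1) (real m / real b)"
  have p01: "0 < p" "p < 1"
    using \<zeta> d nb by (auto simp: p min_less_iff_disj)
  \<comment> \<open>The reciprocals of the two entries are d/\<zeta> = 1 + (d/\<zeta> - 1) and (m +
    b)/b = 1 + m/b. Hence (1 - p)/p = H, the maximum in the stepsize condition.\<close>
  have inv_p: "1 / p = 1 + H"
  proof -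
    have "1 / p = max (1 / (\<zeta> / d)) (1 / (real b / (real m + real b)))"
      unfolding p using \<zeta> d nb by (intro inverse_min) auto
    also have "\<dots> = 1 + H"
      using nb by (simp add: H_def max_add_distrib_right add_divide_distrib)
    finally show ?thesis .
  qed
  have H: "0 \<le> H" "1 / p * (1 - p) = H"
    using nb inv_p p01 by (auto simp: H_def field_simps max_def)
  interpret V: vr_marina M U n m b p \<omega> \<gamma> f Lw \<L>w Q c S \<xi> x0 x g
    using dims p01 diff smooth quant sampling run avg_smooth by unfold_locales auto
  have VL: "V.L = L" "V.\<L> = \<L>"
    by (simp_all add: V.L_def V.\<L>_def L \<L>)
  have L0: "0 \<le> L" "0 \<le> \<L>"
    by (simp_all add: L \<L> sum_nonneg)
  have \<omega>: "0 < \<omega>" by (rule V.\<omega>_pos)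
  define s where "s = sqrt (2 * H / real n * (\<omega> * L\<^sup>2 + (1 + \<omega>) * \<L>\<^sup>2 / real b))"
  have s: "0 \<le> s" "s\<^sup>2 = 2 * H / real n * V.noise_const"
    using H \<omega> nb by (simp_all add: s_def V.noise_const_def VL)
  have \<gamma>: "\<gamma> \<le> 1 / (L + s)" "\<gamma> \<le> p / (2 * \<mu>)" "\<theta> * min (1 / (L + s)) (p / (2 * \<mu>)) \<le> \<gamma>"
    using stepsize(2) stepsize_order(2) by (simp_all add: s_def H_def)
  note step = stepsize_descent_condition[OF stepsize(1) L0(1) s(1) \<gamma>(1)]
  have q: "\<gamma> * \<mu> \<le> p / 2" "0 < \<gamma> * \<mu>"
    using \<gamma>(2) PL(1) stepsize(1) by (simp_all add: pos_le_divide_eq mult.commute mult.left_commute)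
  \<comment> \<open>Follows from the two opposite bounds on \<gamma>; it allows initial costs to be
    enlarged by 1/\<theta>.\<close>
  have \<theta>: "\<theta> \<le> 1"
  proof -
    have "\<theta> * min (1 / (L + s)) (p / (2 * \<mu>)) \<le> 1 * min (1 / (L + s)) (p / (2 * \<mu>))"
      using \<gamma> by simp
    moreover have "0 < min (1 / (L + s)) (p / (2 * \<mu>))"
      using step(1) p01 PL(1) by simp
    ultimately show ?thesis by (rule mult_right_le_imp_le)
  qed
  have gap: "integrable M (\<lambda>s. F (x K s) - F xstar)"
    "(\<integral>s. F (x K s) - F xstar \<partial>M) \<le> (1 - \<gamma> * \<mu>) ^ K * \<Delta>\<^sub>0" for K
  proof -
    have min: "F xstar \<le> F y" for y
      using argmin by (simp add: is_arg_min_linorder)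
    have "\<gamma> / p * (1 - p) * (V.noise_const / real n) = \<gamma> * (1 / p * (1 - p)) * (V.noise_const / real n)"
      by simp
    also have "\<dots> = \<gamma> * (s\<^sup>2 / 2)"
      unfolding H(2) s(2) by simp
    finally have noise: "\<gamma> / p * (1 - p) * (V.noise_const / real n) \<le> 1 / (2 * \<gamma>) - V.L / 2"
      using step(3) by (simp only: VL)
    show "integrable M (\<lambda>s. F (x K s) - F xstar)"
      "(\<integral>s. F (x K s) - F xstar \<partial>M) \<le> (1 - \<gamma> * \<mu>) ^ K * \<Delta>\<^sub>0"
      using V.expected_gap[of \<mu> "F xstar" K] stepsize(1) step(2) q(1) PL noise min
      by (simp_all add: F VL \<Delta>\<^sub>0)
  qed
  define B where "B = max (1 / p) (L / \<mu> * (1 + sqrt (\<omega> * H / real n))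
    + \<L> / \<mu> * sqrt ((1 + \<omega>) * H / (real n * real b)))"
  have B: "0 < B" "1 / (\<gamma> * \<mu>) \<le> 2 * B / \<theta>"
    using inverse_stepsize_bound[OF PL(1) p01(1) stepsize_order(1) stepsize(1) L0 _ H(1) nb(1,2)
        s_def step(1) \<gamma>(3) B_def] \<omega> by simp_all
  define \<Lambda> where "\<Lambda> = ln (\<Delta>\<^sub>0 / \<epsilon>)"
  have \<Lambda>: "0 \<le> \<Lambda>"
    using eps by (simp add: \<Lambda>_def)
  define K where "K = nat \<lceil>\<Lambda> / (\<gamma> * \<mu>)\<rceil>"
  have ratio: "0 \<le> \<Lambda> / (\<gamma> * \<mu>)" "\<Lambda> / (\<gamma> * \<mu>) \<le> 2 / \<theta> * (B * \<Lambda>)"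
    using \<Lambda> q(2) mult_right_mono[OF B(2) \<Lambda>] by (simp_all add: mult.assoc)
  \<comment> \<open>Rounding up may cost one extra round. The bound on the rounds hides it in its
    ceiling; the cost bounds charge it to the initial term in \<open>total\<close>.\<close>
  have K: "\<Lambda> / (\<gamma> * \<mu>) \<le> real K" "real K \<le> 2 / \<theta> * (B * \<Lambda>) + 1"
    using ratio by (simp_all add: K_def) linarith+
  have B\<Lambda>: "0 \<le> B * \<Lambda>" using B \<Lambda> by simp
  have small: "(\<integral>s. F (x K s) - F xstar \<partial>M) \<le> \<epsilon>"
    using gap(2)[of K] geometric_decay_below[OF q(2) _ eps, of K] q(1) p01 K(1)
    by (simp add: \<Lambda>_def)
  have rounds: "int K \<le> \<lceil>10 / \<theta> * (B * \<Lambda>)\<rceil>"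
  proof -
    have "2 / \<theta> * (B * \<Lambda>) \<le> 10 / \<theta> * (B * \<Lambda>)"
      using stepsize_order(1) B\<Lambda> by (intro mult_right_mono divide_right_mono) auto
    then have "\<Lambda> / (\<gamma> * \<mu>) \<le> 10 / \<theta> * (B * \<Lambda>)"
      using ratio(2) by linarith
    then show ?thesis
      using ratio(1) by (simp add: K_def ceiling_mono)
  qed
  \<comment> \<open>Moved under the roots, the factor b becomes b^2, which clears the denominators b
    and so produces the form of the oracle bound.\<close>
  have bB: "max (real b / p)
      (L / \<mu> * (real b + sqrt (\<omega> * max ((d / \<zeta> - 1) * (real b)\<^sup>2) (real m * real b) / real n))
       + \<L> / \<mu> * sqrt ((1 + \<omega>) * max ((d / \<zeta> - 1) * real b) (real m) / real n)) = real b * B"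
  proof -
    have max1: "max ((d / \<zeta> - 1) * (real b)\<^sup>2) (real m * real b) = (real b)\<^sup>2 * H"
      using nb max_mult_distrib_left[of "(real b)\<^sup>2" "d / \<zeta> - 1" "real m / real b"]
      by (simp add: H_def power2_eq_square mult.commute)
    have max2: "max ((d / \<zeta> - 1) * real b) (real m) = real b * H"
      using nb max_mult_distrib_left[of "real b" "d / \<zeta> - 1" "real m / real b"]
      by (simp add: H_def mult.commute)
    have "sqrt (\<omega> * ((real b)\<^sup>2 * H) / real n) = sqrt ((real b)\<^sup>2 * (\<omega> * H / real n))"
      by (simp add: mult.commute mult.left_commute)
    then have sq1: "sqrt (\<omega> * ((real b)\<^sup>2 * H) / real n) = real b * sqrt (\<omega> * H / real n)"
      by (simp only: real_sqrt_mult) simp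
    have "sqrt ((1 + \<omega>) * (real b * H) / real n) = sqrt ((real b)\<^sup>2 * ((1 + \<omega>) * H / (real n * real b)))"
      using nb by (simp add: power2_eq_square field_simps)
    then have sq2: "sqrt ((1 + \<omega>) * (real b * H) / real n) = real b * sqrt ((1 + \<omega>) * H / (real n * real b))"
      by (simp only: real_sqrt_mult) simp
    show ?thesis
      unfolding max1 max2 sq1 sq2 B_def using nb
      by (simp add: max_mult_distrib_left algebra_simps)
  qed
  have inv_\<theta>: "1 \<le> 1 / \<theta>"
    using \<theta> stepsize_order(1) by simp
  \<comment> \<open>\<open>r\<close> is the initial cost and \<open>a + 2 * t\<close> that of one
    round, at most 3t. The extra round costs at most 3t \<le> 3r, so r gets the coefficient 4 and t
    B \<Lambda> / \<theta> the coefficient 6; both are rounded up to 10.\<close>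
  have total: "r + real K * (a + 2 * t) \<le> 10 / \<theta> * (r + t * B * \<Lambda>)"
    if "0 \<le> t" "a \<le> t" "t \<le> r" for r a t
  proof -
    have "real K * (a + 2 * t) \<le> (2 / \<theta> * (B * \<Lambda>) + 1) * (3 * t)"
      using that K(2) B\<Lambda> stepsize_order(1)
      by (intro order_trans[OF mult_left_mono mult_right_mono]) auto
    then have "r + real K * (a + 2 * t) \<le> 4 * r + 6 * (1 / \<theta> * (t * B * \<Lambda>))"
      using that by (simp add: algebra_simps)
    also have "\<dots> \<le> 10 * (1 / \<theta> * r) + 10 * (1 / \<theta> * (t * B * \<Lambda>))"
    proof (intro add_mono mult_mono)
      show "r \<le> 1 / \<theta> * r"
        using mult_right_mono[OF inv_\<theta>, of r] that by simp
    qed (use that B\<Lambda> stepsize_order(1) B(1) \<Lambda> in auto)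
    also have "\<dots> = 10 / \<theta> * (r + t * B * \<Lambda>)"
      by (simp add: add_divide_distrib distrib_left)
    finally show ?thesis .
  qed
  have calls: "(\<integral>s. real (oracle_calls m b (\<lambda>k. c k s) K) \<partial>M) \<le> 10 / \<theta> * (real m + real b * B * \<Lambda>)"
  proof -
    \<comment> \<open>The second entry of p makes full gradients cost on average no more than b
      calls per round; the first entry later does the same for dense vectors and \<zeta>.\<close>
    have "real m * p \<le> real m * (real b / (real m + real b))"
      using nb by (intro mult_left_mono) (auto simp: p)
    also have "\<dots> \<le> real b"
      using nb by (simp add: field_simps)
    finally show ?thesis
      using V.expected_oracle_calls[of K] total[of "real b" "real m * p" "real m"] dims by simp
  qed
  have communication: "(\<integral>s. cost i K s \<partial>M) \<le> 10 / \<theta> * \<kappa> * (d + \<zeta> * B * \<Lambda>)" if i: "i \<in> {1..n}" for i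
  proof -
    have "d * p \<le> d * (\<zeta> / d)"
      using d by (intro mult_left_mono) (auto simp: p)
    then have pd: "d * p \<le> \<zeta>" using d by simp
    have "(\<integral>s. cost i K s \<partial>M) = \<kappa> * (\<integral>s. real (sent_components m b f (\<lambda>k. c k s) (\<lambda>i k. S i k s)
        (\<lambda>i k. Q (\<xi> i k s)) (\<lambda>k. x k s) i K) \<partial>M)"
      using cost(2)[OF i] by (subst integral_mult_right_zero[symmetric]) (intro Bochner_Integration.integral_cong; simp)
    also have "\<dots> \<le> \<kappa> * (d + real K * (d * p + \<zeta>))"
      using V.expected_sent_components[OF i, of K] cost(1) dims \<open>\<zeta> = expected_density U Q\<close>
      by (intro mult_left_mono) auto
    \<comment> \<open>One more \<zeta> is granted to match the shape of \<open>total\<close>, which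
      is fitted to the 2b calls of a minibatch round.\<close>
    also have "\<dots> \<le> \<kappa> * (d + real K * (d * p + 2 * \<zeta>))"
      using cost(1) \<zeta> by (intro mult_left_mono add_left_mono) auto
    also have "\<dots> \<le> \<kappa> * (10 / \<theta> * (d + \<zeta> * B * \<Lambda>))"
      using total[of \<zeta> "d * p" d] pd \<zeta> cost(1) by (intro mult_left_mono) auto
    finally show ?thesis by (simp add: mult.commute mult.left_commute)
  qed
  show ?thesis
    unfolding bB unfolding H_def[symmetric] B_def[symmetric] \<Lambda>_def[symmetric]
    using gap(1) small rounds calls communication by (intro exI[of _ K]) blast
qed

end
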